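(* Let $G$ be an antiprismatic thickening. Then $\chi(G)\leq \gamma_\ell(G)$, where $\gamma_\ell(G)=\max_{v\in V(G)}\left\lceil \tfrac12\bigl(d(v)+1+\omega(v)\bigr)\right\rceil$.
   Context: $d(v)$ is the degree of $v$ and $\omega(v)$ is the maximum size of a clique containing $v$. A triad is a stable set of size three. A graph $H$ is antiprismatic if for every triad $T$, every vertex of $H-T$ has exactly two neighbours in $T$. A matching $M$ (a set of pairwise disjoint pairs of vertices, here edges of $H$) is changeable in an antiprismatic graph $H$ if $H-M'$ is antiprismatic for every $M'\subseteq M$. Given a graph $H$ and a matching $M\subseteq E(H)$, a graph $G$ is a thickening of $H$ under $M$ if it is obtained as follows: replace each vertex $v$ of $H$ by a nonempty clique $I(v)$ (the cliques being disjoint), with $I(u)$ complete to $I(v)$ if $uv\in E(H)$ and anticomplete otherwise; then for every $uv\in M$ remove a nonempty proper subset of the edges between $I(u)$ and $I(v)$. An antiprismatic thickening is a thickening of an antiprismatic graph $H$ under a changeable matching $M$ of $H$. *)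

theory Defs
  imports Complex_Main "HOL-Library.Disjoint_Sets"
begin

text \<open>Graphs are finite, simple and undirected; an edge is the two-element set of its ends.\<close>

record 'a graph =
  verts :: "'a set"
  edges :: "'a set set"

definition simple_graph :: "'a graph \<Rightarrow> bool" where
  "simple_graph G \<longleftrightarrow> finite (verts G) \<and> (\<forall>e\<in>edges G. e \<subseteq> verts G \<and> card e = 2)"

definition del_edges :: "'a graph \<Rightarrow> 'a set set \<Rightarrow> 'a graph" where
  "del_edges G M = G\<lparr>edges := edges G - M\<rparr>"

definition neighbours :: "'a graph \<Rightarrow> 'a \<Rightarrow> 'a set" where
  "neighbours G v = {u \<in> verts G. {u, v} \<in> edges G}"

definition degree :: "'a graph \<Rightarrow> 'a \<Rightarrow> nat" where
  "degree G v = card (neighbours G v)"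

definition clique :: "'a graph \<Rightarrow> 'a set \<Rightarrow> bool" where
  "clique G K \<longleftrightarrow> K \<subseteq> verts G \<and> (\<forall>x\<in>K. \<forall>y\<in>K. x \<noteq> y \<longrightarrow> {x, y} \<in> edges G)"

definition stable :: "'a graph \<Rightarrow> 'a set \<Rightarrow> bool" where
  "stable G S \<longleftrightarrow> S \<subseteq> verts G \<and> (\<forall>x\<in>S. \<forall>y\<in>S. {x, y} \<notin> edges G)"

definition local_clique_number :: "'a graph \<Rightarrow> 'a \<Rightarrow> nat" where
  "local_clique_number G v = Max {card K | K. clique G K \<and> v \<in> K}"

definition colourable :: "'a graph \<Rightarrow> nat \<Rightarrow> bool" where
  "colourable G k \<longleftrightarrow> (\<exists>c :: 'a \<Rightarrow> nat. c ` verts G \<subseteq> {..<k} \<and>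
     (\<forall>u\<in>verts G. \<forall>v\<in>verts G. {u, v} \<in> edges G \<longrightarrow> c u \<noteq> c v))"

definition chromatic_number :: "'a graph \<Rightarrow> nat" where
  "chromatic_number G = (LEAST k. colourable G k)"

text \<open>The supremum of a finite nonempty set of naturals is its maximum; for the graph
  without vertices it is \<open>0\<close>, whereas \<^const>\<open>Max\<close> would be unspecified there.\<close>

definition gamma_local :: "'a graph \<Rightarrow> nat" where
  "gamma_local G =
     (SUP v\<in>verts G. nat \<lceil>(1/2 :: real) * real (degree G v + 1 + local_clique_number G v)\<rceil>)"

definition triad :: "'a graph \<Rightarrow> 'a set \<Rightarrow> bool" where
  "triad G T \<longleftrightarrow> stable G T \<and> card T = 3"

definition antiprismatic :: "'a graph \<Rightarrow> bool" where
  "antiprismatic G \<longleftrightarrow>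
     (\<forall>T. triad G T \<longrightarrow> (\<forall>v\<in>verts G - T. card (neighbours G v \<inter> T) = 2))"

definition matching :: "'a graph \<Rightarrow> 'a set set \<Rightarrow> bool" where
  "matching G M \<longleftrightarrow> M \<subseteq> edges G \<and> disjoint M"

definition changeable :: "'a graph \<Rightarrow> 'a set set \<Rightarrow> bool" where
  "changeable G M \<longleftrightarrow> (\<forall>M'. M' \<subseteq> M \<longrightarrow> antiprismatic (del_edges G M'))"

definition edges_between :: "'a set \<Rightarrow> 'a set \<Rightarrow> 'a set set" where
  "edges_between A B = {{x, y} | x y. x \<in> A \<and> y \<in> B}"

definition blowup_edges :: "'b graph \<Rightarrow> ('b \<Rightarrow> 'a set) \<Rightarrow> 'a set set" where
  "blowup_edges H I =
     {{x, y} | x y v. v \<in> verts H \<and> x \<in> I v \<and> y \<in> I v \<and> x \<noteq> y} \<union>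
     \<Union>{edges_between (I u) (I v) | u v. {u, v} \<in> edges H}"

text \<open>\<open>R\<close> collects the removed edges of all pairs in \<open>M\<close>. In particular, \<open>I u\<close> and \<open>I v\<close> cannot
  both be singletons if \<open>{u, v} \<in> M\<close>.\<close>

definition thickening :: "'a graph \<Rightarrow> 'b graph \<Rightarrow> 'b set set \<Rightarrow> bool" where
  "thickening G H M \<longleftrightarrow>
     (\<exists>I R. (\<forall>v\<in>verts H. I v \<noteq> {}) \<and> disjoint_family_on I (verts H) \<and>
        verts G = (\<Union>v\<in>verts H. I v) \<and>
        R \<subseteq> \<Union>{edges_between (I u) (I v) | u v. {u, v} \<in> M} \<and>
        (\<forall>u v. {u, v} \<in> M \<longrightarrow>
           R \<inter> edges_between (I u) (I v) \<noteq> {} \<and>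
           R \<inter> edges_between (I u) (I v) \<subset> edges_between (I u) (I v)) \<and>
        edges G = blowup_edges H I - R)"

definition antiprismatic_thickening :: "'a graph \<Rightarrow> 'b graph \<Rightarrow> 'b set set \<Rightarrow> bool" where
  "antiprismatic_thickening G H M \<longleftrightarrow>
     simple_graph H \<and> antiprismatic H \<and> matching H M \<and> changeable H M \<and> thickening G H M"

end

theory Submission imports Defs begin

text \<open>For each edge \<open>uv\<close> of \<open>M\<close>, delete the edges between \<open>I(u)\<close> and \<open>I(v)\<close> that do not lie inside one
  fixed maximum clique of the union. By Koenig's theorem every colouring of the remaining graph can be
  permuted within \<open>I(u)\<close> and \<open>I(v)\<close> to a colouring of \<open>G\<close>. Now two vertices of the same \<open>I(v)\<close> have
  nested closed neighbourhoods, and since \<open>H - M\<close> is antiprismatic, a vertex outside a triad \<open>T\<close> has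
  two neighbours in \<open>T\<close> unless its only neighbour there belongs to the same \<open>I(v)\<close>. Removing a triad
  of maximum degree sum therefore lowers \<open>d(v) + 1 + \<omega>(v)\<close> by at least two for each remaining vertex
  \<open>v\<close>, at the price of one colour. A graph without triads is coloured by a maximum matching of its
  complement, and the argument behind Gallai's lemma bounds the number of unmatched vertices.\<close>

section \<open>Pairings\<close>

text \<open>A matching is encoded as an involution \<open>f\<close> whose fixed points are the unmatched elements, so
  maximum matchings are the involutions with the fewest fixed points.\<close>

definition pairing :: "'a set \<Rightarrow> ('a \<Rightarrow> 'a \<Rightarrow> bool) \<Rightarrow> ('a \<Rightarrow> 'a) \<Rightarrow> bool" where
  "pairing V N f \<longleftrightarrow> (\<forall>x\<in>V. f x \<in> V \<and> f (f x) = x \<and> (f x = x \<or> N x (f x)))"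

definition fixpts :: "'a set \<Rightarrow> ('a \<Rightarrow> 'a) \<Rightarrow> 'a set" where
  "fixpts V f = {x\<in>V. f x = x}"

definition optimal :: "'a set \<Rightarrow> ('a \<Rightarrow> 'a \<Rightarrow> bool) \<Rightarrow> ('a \<Rightarrow> 'a) \<Rightarrow> bool" where
  "optimal V N f \<longleftrightarrow> pairing V N f \<and>
     (\<forall>g. pairing V N g \<longrightarrow> card (fixpts V f) \<le> card (fixpts V g))"

text \<open>The relation behind Gallai's lemma. The disjunct \<open>u = w\<close> makes it
  reflexive, and by \<open>linked_trans\<close> it is an equivalence relation on \<open>V\<close>
  once every element is missed by some maximum matching.\<close>

definition linked :: "'a set \<Rightarrow> ('a \<Rightarrow> 'a \<Rightarrow> bool) \<Rightarrow> 'a \<Rightarrow> 'a \<Rightarrow> bool" where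
  "linked V N u w \<longleftrightarrow> u = w \<or> (\<forall>f. optimal V N f \<longrightarrow> \<not> (f u = u \<and> f w = w))"

lemma pairing_id: "pairing V N (\<lambda>x. x)"
  by (simp add: pairing_def)

lemma optimal_exists: "\<exists>f. optimal V N f"
  using ex_has_least_nat[of "pairing V N" "\<lambda>x. x" "\<lambda>f. card (fixpts V f)"] pairing_id
  unfolding optimal_def by blast

text \<open>Non-fixed elements form disjoint orbits of size two, fixed ones form singletons. Orbits
  later become colour classes, so \<open>card V + card (fixpts V f)\<close> is twice a number of
  colours and is the quantity bounded throughout.\<close>

lemma card_orbits:
  assumes "finite V" "pairing V N f"
  shows "2 * card ((\<lambda>x. {x, f x}) ` V) = card V + card (fixpts V f)"
proof -
  let ?o = "\<lambda>x. {x, f x}"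
  let ?F = "fixpts V f"
  let ?D = "V - ?F"
  have inv: "f x \<in> V" "f (f x) = x" if "x \<in> V" for x
    using assms(2) that by (auto simp: pairing_def)
  have D: "f x \<in> ?D" if "x \<in> ?D" for x
    using that inv by (auto simp: fixpts_def)
  have "finite ?D" "finite ?F"
    using assms(1) by (auto simp: fixpts_def)
  have union: "\<Union>(?o ` ?D) = ?D"
  proof (intro subset_antisym Union_least)
    show "c \<subseteq> ?D" if c: "c \<in> ?o ` ?D" for c
    proof -
      obtain y where "y \<in> ?D" "c = {y, f y}" using c by blast
      then show ?thesis using D[of y] by simp
    qed
  qed blast
  have "2 * card (?o ` ?D) = card (\<Union>(?o ` ?D))"
  proof (rule card_partition)
    show "finite (?o ` ?D)" "finite (\<Union>(?o ` ?D))"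
      using \<open>finite ?D\<close> union by auto
    show "card c = 2" if "c \<in> ?o ` ?D" for c
      using that by (auto simp: fixpts_def card_2_iff)
    show "c1 \<inter> c2 = {}" if c: "c1 \<in> ?o ` ?D" "c2 \<in> ?o ` ?D" "c1 \<noteq> c2" for c1 c2
    proof (rule ccontr)
      assume "c1 \<inter> c2 \<noteq> {}"
      moreover obtain x where "c1 = {x, f x}" "x \<in> V"
        using c(1) by blast
      moreover obtain y where "c2 = {y, f y}" "y \<in> V"
        using c(2) by blast
      ultimately have "x = y \<or> x = f y \<or> f x = y \<or> f x = f y" by auto
      then have "c1 = c2"
        using inv[OF \<open>x \<in> V\<close>] inv[OF \<open>y \<in> V\<close>] unfolding \<open>c1 = _\<close> \<open>c2 = _\<close>
        by (metis insert_commute)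
      with c show False by simp
    qed
  qed
  then have 1: "2 * card (?o ` ?D) = card ?D" using union by simp
  have "?o ` ?F = (\<lambda>x. {x}) ` ?F" by (auto simp: fixpts_def)
  then have 2: "card (?o ` ?F) = card ?F" by (simp add: card_image)
  have "?o ` V = ?o ` ?D \<union> ?o ` ?F" by (auto simp: fixpts_def)
  moreover have "?o ` ?D \<inter> ?o ` ?F = {}"
    using inv by (auto simp: fixpts_def doubleton_eq_iff)
  ultimately have 3: "card (?o ` V) = card (?o ` ?D) + card (?o ` ?F)"
    using \<open>finite ?D\<close> \<open>finite ?F\<close> by (simp add: card_Un_disjoint)
  have "card V = card ?D + card ?F"
    using card_Diff_subset[OF \<open>finite ?F\<close>] card_mono[OF assms(1)] by (force simp: fixpts_def)
  with 1 2 3 show ?thesis by simp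
qed

text \<open>Parity supplies the last unit in \<open>pairing_extend\<close> and
  \<open>pairing_without_triads\<close>, where counting alone falls one short.\<close>

lemma pairing_parity:
  assumes "finite V" "pairing V N f"
  shows "even (card V + card (fixpts V f))"
  using card_orbits[OF assms] by (metis dvd_triv_left)

text \<open>The set \<open>S\<close> is the vertex set of the alternating path that starts at \<open>v\<close> with the pair
  given by \<open>f\<close>; it is cut off at the first fixed point of \<open>f\<close>, and is a whole component of the union
  of the two pairings.\<close>

lemma alternating_path:
  assumes f: "pairing V N f" and g: "pairing V N g" and v: "v \<in> V" "g v = v"
  obtains S where "S \<subseteq> V" "v \<in> S" "\<And>x. x \<in> S \<Longrightarrow> f x \<in> S" "\<And>x. x \<in> S \<Longrightarrow> g x \<in> S"
    "\<And>x y. x \<in> S \<Longrightarrow> y \<in> S \<Longrightarrow> f x = x \<Longrightarrow> f y = y \<Longrightarrow> x = y"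
proof -
  \<comment> \<open>\<open>f\<close> is applied at even steps and \<open>g\<close> at odd ones.
    Since \<open>g v = v\<close>, the path does not continue backwards beyond \<open>v\<close>;
    where \<open>g\<close> fixes a later vertex, the sequence turns round and retraces itself,
    adding no new vertices.\<close>
  define a where "a = rec_nat v (\<lambda>k x. if even k then f x else g x)"
  have a0: "a 0 = v" and aS: "a (Suc k) = (if even k then f (a k) else g (a k))" for k
    by (simp_all add: a_def)
  have aV: "a k \<in> V" for k
    by (induction k) (use f g v in \<open>auto simp: a0 aS pairing_def\<close>)
  have ff: "f (f (a k)) = a k" and gg: "g (g (a k)) = a k" for k
    using aV[of k] f g by (auto simp: pairing_def)
  define S where "S = {a j | j. \<forall>i<j. f (a i) \<noteq> a i}"
  have "f x \<in> S" if x: "x \<in> S" for x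
  proof -
    obtain j where j: "x = a j" "\<forall>i<j. f (a i) \<noteq> a i" using x unfolding S_def by blast
    show ?thesis
    proof (cases "even j")
      case True
      show ?thesis
      proof (cases "f (a j) = a j")
        case False
        then have "\<forall>i<Suc j. f (a i) \<noteq> a i" using j less_Suc_eq by auto
        moreover have "f x = a (Suc j)" using True j by (simp add: aS)
        ultimately show ?thesis unfolding S_def by blast
      qed (use that j in simp)
    next
      case False
      then obtain i where i: "j = Suc i" "even i" by (cases j) auto
      then have "f x = a i" using j by (simp add: aS ff)
      then show ?thesis using j i by (auto simp: S_def)
    qed
  qed
  moreover have "g x \<in> S" if x: "x \<in> S" for x
  proof -
    obtain j where j: "x = a j" "\<forall>i<j. f (a i) \<noteq> a i" using x unfolding S_def by blast
    show ?thesis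
    proof (cases "even j")
      case True
      show ?thesis
      proof (cases j)
        case 0
        then show ?thesis using x j v a0 by simp
      next
        case (Suc i)
        then have "g x = a i" using j True by (simp add: aS gg)
        then show ?thesis using j Suc by (auto simp: S_def)
      qed
    next
      case False
      then obtain i where i: "j = Suc i" "even i" by (cases j) auto
      then have "f (a j) \<noteq> a j" using j by (metis aS ff lessI)
      then have "\<forall>i<Suc j. f (a i) \<noteq> a i" using j less_Suc_eq by auto
      moreover have "g x = a (Suc j)" using False j by (simp add: aS)
      ultimately show ?thesis unfolding S_def by blast
    qed
  qed
  \<comment> \<open>Of two different indices whose values are fixed by \<open>f\<close>, the smaller
    would violate the cut-off condition of the larger.\<close>
  moreover have "x = y" if xy: "x \<in> S" "y \<in> S" "f x = x" "f y = y" for x y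
  proof -
    obtain i j where "x = a i" "y = a j" "\<forall>k<i. f (a k) \<noteq> a k" "\<forall>k<j. f (a k) \<noteq> a k"
      using xy unfolding S_def by blast
    then show ?thesis using xy by (metis linorder_neqE_nat)
  qed
  moreover have "v \<in> S" using a0 by (force simp: S_def)
  moreover have "S \<subseteq> V" using aV by (auto simp: S_def)
  ultimately show ?thesis using that by blast
qed

section \<open>Exchange along an alternating path\<close>

lemma card_fixpts_split:
  assumes "finite V" "S \<subseteq> V"
  shows "card (fixpts V f) = card (fixpts S f) + card (fixpts (V - S) f)"
proof -
  have "fixpts V f = fixpts S f \<union> fixpts (V - S) f" "fixpts S f \<inter> fixpts (V - S) f = {}"
    using assms by (auto simp: fixpts_def)
  moreover have "finite (fixpts V f)" using assms by (simp add: fixpts_def)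
  ultimately show ?thesis by (metis card_Un_disjoint finite_Un)
qed

lemma pairing_swap:
  assumes "pairing V N f" "pairing V N g"
    and "\<And>x. x \<in> S \<Longrightarrow> f x \<in> S" "\<And>x. x \<in> S \<Longrightarrow> g x \<in> S"
  shows "pairing V N (\<lambda>x. if x \<in> S then g x else f x)"
proof -
  have "f x \<notin> S" if "x \<in> V" "x \<notin> S" for x
    using that assms by (metis pairing_def)
  then show ?thesis using assms unfolding pairing_def by auto
qed

lemma fixpts_swap:
  "fixpts S (\<lambda>x. if x \<in> S then g x else f x) = fixpts S g"
  "fixpts (V - S) (\<lambda>x. if x \<in> S then g x else f x) = fixpts (V - S) f"
  by (auto simp: fixpts_def)

text \<open>Exchange \<open>f\<close> and \<open>g\<close> on the alternating path \<open>S\<close>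
  from \<open>v\<close>. The two new pairings together have as many fixed points as \<open>f\<close>
  and \<open>g\<close>, so \<open>h\<close> cannot exceed the minimum. It fixes \<open>v\<close> as
  \<open>g\<close> does, and since \<open>S\<close> contains at most one fixed point of
  \<open>f\<close>, one of \<open>u\<close> and \<open>w\<close> lies outside \<open>S\<close> and
  stays fixed.\<close>

lemma optimal_exchange:
  assumes "finite V" and f: "optimal V N f" and g: "optimal V N g"
    and v: "v \<in> V" "g v = v" and uw: "u \<noteq> w" "f u = u" "f w = w"
  shows "\<exists>h. optimal V N h \<and> h v = v \<and> (h u = u \<or> h w = w)"
proof -
  have pf: "pairing V N f" and pg: "pairing V N g" using f g by (auto simp: optimal_def)
  obtain S where S: "S \<subseteq> V" "v \<in> S" "\<And>x. x \<in> S \<Longrightarrow> f x \<in> S" "\<And>x. x \<in> S \<Longrightarrow> g x \<in> S"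
    "\<And>x y. x \<in> S \<Longrightarrow> y \<in> S \<Longrightarrow> f x = x \<Longrightarrow> f y = y \<Longrightarrow> x = y"
    using alternating_path[OF pf pg v] by blast
  define h where "h = (\<lambda>x. if x \<in> S then g x else f x)"
  define h' where "h' = (\<lambda>x. if x \<in> S then f x else g x)"
  have ph: "pairing V N h" and ph': "pairing V N h'"
    unfolding h_def h'_def by (rule pairing_swap; use pf pg S in blast)+
  have "card (fixpts V h) + card (fixpts V h') = card (fixpts V f) + card (fixpts V g)"
    unfolding h_def h'_def card_fixpts_split[OF assms(1) S(1)] fixpts_swap by simp
  moreover have "card (fixpts V g) \<le> card (fixpts V h')" using g ph' by (auto simp: optimal_def)
  ultimately have "card (fixpts V h) \<le> card (fixpts V f)" by simp
  then have "optimal V N h" using f ph unfolding optimal_def by (meson le_trans)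
  moreover have "h v = v" using S v by (simp add: h_def)
  moreover have "h u = u \<or> h w = w" using S(5)[of u w] uw by (auto simp: h_def)
  ultimately show ?thesis by blast
qed

section \<open>Gallai's argument and Koenig's theorem\<close>

lemma linked_sym: "linked V N u w \<Longrightarrow> linked V N w u"
  by (auto simp: linked_def)

text \<open>The core of Gallai's lemma: a maximum matching missing both \<open>u\<close> and
  \<open>w\<close> could be exchanged, with the help of \<open>g\<close>, for one missing
  \<open>v\<close> together with \<open>u\<close> or \<open>w\<close>, against one of the two
  assumed links.\<close>

lemma linked_trans:
  assumes "finite V" "v \<in> V" "optimal V N g" "g v = v" "linked V N u v" "linked V N v w"
  shows "linked V N u w"
proof (rule ccontr)
  assume "\<not> linked V N u w"
  then obtain f where f: "u \<noteq> w" "optimal V N f" "f u = u" "f w = w"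
    by (auto simp: linked_def)
  obtain h where "optimal V N h" "h v = v" "h u = u \<or> h w = w"
    using optimal_exchange[OF assms(1) f(2) assms(3,2,4) f(1,3,4)] by blast
  then have "u = v \<or> v = w" using assms(5,6) unfolding linked_def by blast
  then show False using assms(5,6) f unfolding linked_def by blast
qed

text \<open>An optimal pairing that missed both could join them and would lose two fixed
  points.\<close>

lemma linked_if_related:
  assumes "finite V" "u \<in> V" "w \<in> V" "N u w" "N w u"
  shows "linked V N u w"
proof (rule ccontr)
  assume "\<not> linked V N u w"
  then obtain f where "u \<noteq> w" "optimal V N f" and fx: "f u = u" "f w = w"
    by (auto simp: linked_def)
  then have pf: "pairing V N f" by (simp add: optimal_def)
  let ?g = "f(u := w, w := u)"
  have "f x \<noteq> u" "f x \<noteq> w" if "x \<in> V" "x \<noteq> u" "x \<noteq> w" for x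
  proof -
    have "f (f x) = x" using pf that(1) by (simp add: pairing_def)
    then show "f x \<noteq> u" "f x \<noteq> w" using that fx by auto
  qed
  then have "pairing V N ?g" using pf assms \<open>u \<noteq> w\<close> by (auto simp: pairing_def)
  moreover have "fixpts V ?g \<subset> fixpts V f"
    using assms fx \<open>u \<noteq> w\<close> by (auto simp: fixpts_def)
  then have "card (fixpts V ?g) < card (fixpts V f)"
    using assms(1) by (intro psubset_card_mono) (auto simp: fixpts_def)
  ultimately show False using \<open>optimal V N f\<close> by (auto simp: optimal_def dest: leD)
qed

text \<open>Extending \<open>g\<close> by the fixed point \<open>v\<close> is not optimal, so an
  optimal pairing of \<open>V\<close> has fewer fixed points, and by parity at least two fewer. Thus
  an element covered by every optimal pairing can be deleted without loss, which is the inductive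
  step of \<open>koenig\<close> and \<open>pairing_without_triads\<close>.\<close>

lemma pairing_extend:
  assumes "finite V" "v \<in> V" "pairing (V - {v}) N g" "\<forall>f. optimal V N f \<longrightarrow> f v \<noteq> v"
  shows "\<exists>f. pairing V N f \<and> card V + card (fixpts V f) \<le> card (V - {v}) + card (fixpts (V - {v}) g)"
proof -
  let ?g = "g(v := v)"
  obtain f where f: "optimal V N f" using optimal_exists by blast
  then have pf: "pairing V N f" by (simp add: optimal_def)
  have pg: "pairing V N ?g"
    unfolding pairing_def
  proof
    fix x assume "x \<in> V"
    show "?g x \<in> V \<and> ?g (?g x) = x \<and> (?g x = x \<or> N x (?g x))"
    proof (cases "x = v")
      case False
      then have "g x \<in> V - {v} \<and> g (g x) = x \<and> (g x = x \<or> N x (g x))"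
        using assms(3) \<open>x \<in> V\<close> unfolding pairing_def by blast
      then show ?thesis using False by auto
    qed (use assms(2) in simp)
  qed
  have "fixpts V ?g = insert v (fixpts (V - {v}) g)" using assms(2) by (auto simp: fixpts_def)
  moreover have "finite (fixpts (V - {v}) g)" "v \<notin> fixpts (V - {v}) g"
    using assms(1) by (auto simp: fixpts_def)
  ultimately have cg: "card (fixpts V ?g) = Suc (card (fixpts (V - {v}) g))" by simp
  have "\<not> optimal V N ?g" using assms(4) by force
  then obtain g' where "pairing V N g'" "card (fixpts V g') < card (fixpts V ?g)"
    using pg by (auto simp: optimal_def not_le)
  then have less: "card (fixpts V f) < card (fixpts V ?g)"
    using f unfolding optimal_def by (blast intro: le_less_trans)
  have even: "even (card V + card (fixpts V f))" "even (card V + card (fixpts V ?g))"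
    using pairing_parity[OF assms(1)] pf pg by blast+
  then have "card (fixpts V f) \<noteq> card (fixpts (V - {v}) g)" using cg even by auto
  moreover have "card V = Suc (card (V - {v}))" using card.remove[OF assms(1,2)] by simp
  ultimately have "card V + card (fixpts V f) \<le> card (V - {v}) + card (fixpts (V - {v}) g)"
    using cg less by linarith
  then show ?thesis using pf by blast
qed

text \<open>An optimal \<open>f\<close> that fixes \<open>u\<close> moves every other member of the
  class of \<open>u\<close>. Partners are linked, so \<open>f\<close> stays within the class, and it
  crosses between the two sides. Hence the members outside \<open>X\<close> inject into those inside
  \<open>X\<close> other than \<open>u\<close>.\<close>

lemma linked_class_unbalanced:
  assumes "finite V" and sym: "\<And>x y. N x y \<Longrightarrow> N y x"
    and bip: "\<And>x y. N x y \<Longrightarrow> x \<in> X \<longleftrightarrow> y \<notin> X"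
    and fixable: "\<And>v. v \<in> V \<Longrightarrow> \<exists>f. optimal V N f \<and> f v = v"
    and u: "u \<in> V" "u \<in> X"
  shows "card ({x\<in>V. linked V N u x} - X) < card ({x\<in>V. linked V N u x} \<inter> X)"
proof -
  let ?C = "{x\<in>V. linked V N u x}"
  obtain f where f: "optimal V N f" "f u = u" using fixable u by blast
  then have pf: "pairing V N f" by (simp add: optimal_def)
  have "f x \<in> ?C \<inter> X - {u}" if x: "x \<in> ?C - X" for x
  proof -
    have "x \<noteq> u" using x u by auto
    then have "f x \<noteq> x" using x f by (auto simp: linked_def)
    then have N: "N x (f x)" and fV: "f x \<in> V" "f (f x) = x" using pf x by (auto simp: pairing_def)
    have "linked V N x (f x)" using linked_if_related[OF assms(1)] x fV N sym by blast
    moreover obtain g where "optimal V N g" "g x = x" using fixable x by blast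
    ultimately have "linked V N u (f x)" using linked_trans[OF assms(1)] x by blast
    then show ?thesis using bip[OF N] x fV f \<open>x \<noteq> u\<close> by auto
  qed
  moreover have "inj_on f (?C - X)"
    using pf by (intro inj_onI) (auto simp: pairing_def, metis)
  moreover have fin: "finite (?C \<inter> X)" using assms(1) by simp
  ultimately have "card (?C - X) \<le> card (?C \<inter> X - {u})"
    by (intro card_inj_on_le[of f]) auto
  moreover have "u \<in> ?C \<inter> X" using u by (simp add: linked_def)
  then have "card (?C \<inter> X - {u}) < card (?C \<inter> X)" using fin by (intro card_Diff1_less)
  ultimately show ?thesis by simp
qed

text \<open>Elements covered by every optimal pairing are deleted one by one. If there are none,
  \<open>N\<close> has no edge inside \<open>V\<close>: both ends of an edge would have the same
  linked class, and that class would have its majority on both sides at once. The inequality is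
  Koenig's theorem, as its left side is twice the difference of \<open>card V\<close> and the number
  of pairs.\<close>

lemma koenig:
  assumes "finite V" and sym: "\<And>x y. N x y \<Longrightarrow> N y x"
    and bip: "\<And>x y. N x y \<Longrightarrow> x \<in> X \<longleftrightarrow> y \<notin> X"
  shows "\<exists>f K. pairing V N f \<and> K \<subseteq> V \<and> (\<forall>x\<in>K. \<forall>y\<in>K. \<not> N x y) \<and>
           card V + card (fixpts V f) \<le> 2 * card K"
  using assms(1)
proof (induction V rule: finite_psubset_induct)
  case (psubset V)
  show ?case
  proof (cases "\<exists>v\<in>V. \<forall>f. optimal V N f \<longrightarrow> f v \<noteq> v")
    case True
    then obtain v where v: "v \<in> V" "\<forall>f. optimal V N f \<longrightarrow> f v \<noteq> v" by blast
    then have "V - {v} \<subset> V" by blast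
    from psubset.IH[OF this] obtain g K where gK: "pairing (V - {v}) N g" "K \<subseteq> V - {v}"
      "\<forall>x\<in>K. \<forall>y\<in>K. \<not> N x y" "card (V - {v}) + card (fixpts (V - {v}) g) \<le> 2 * card K"
      by blast
    obtain f where f: "pairing V N f"
      "card V + card (fixpts V f) \<le> card (V - {v}) + card (fixpts (V - {v}) g)"
      using pairing_extend[OF psubset.hyps v(1) gK(1) v(2)] by blast
    have "K \<subseteq> V" using gK by blast
    then show ?thesis
      using f gK(3) order_trans[OF f(2) gK(4)] by (intro exI[of _ f] exI[of _ K]) simp
  next
    case False
    then have fixable: "\<exists>f. optimal V N f \<and> f v = v" if "v \<in> V" for v using that by blast
    have bip': "x \<in> -X \<longleftrightarrow> y \<notin> -X" if "N x y" for x y using bip that by auto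
    have no: False if uw: "u \<in> V" "w \<in> V" "u \<in> X" "N u w" for u w
    proof -
      have l: "linked V N u w" using linked_if_related[OF psubset.hyps] uw sym by blast
      obtain f where f: "optimal V N f" "f u = u" using fixable uw(1) by blast
      obtain g where g: "optimal V N g" "g w = w" using fixable uw(2) by blast
      have C: "{x\<in>V. linked V N w x} = {x\<in>V. linked V N u x}"
        using linked_trans[OF psubset.hyps uw(2) g l]
          linked_trans[OF psubset.hyps uw(1) f linked_sym[OF l]] by blast
      have "w \<in> -X" using bip uw by auto
      have "card ({x\<in>V. linked V N w x} - -X) < card ({x\<in>V. linked V N w x} \<inter> -X)"
        by (rule linked_class_unbalanced[OF psubset.hyps])
          (fact sym bip' fixable uw(2) \<open>w \<in> -X\<close>)+
      moreover have "card ({x\<in>V. linked V N u x} - X) < card ({x\<in>V. linked V N u x} \<inter> X)"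
        by (rule linked_class_unbalanced[OF psubset.hyps])
          (fact sym bip fixable uw(1,3))+
      ultimately show False unfolding C by (simp add: Diff_eq)
    qed
    have "\<not> N x y" if xy: "x \<in> V" "y \<in> V" for x y
    proof
      assume N: "N x y"
      show False
      proof (cases "x \<in> X")
        case True
        show False by (rule no[OF xy True N])
      next
        case False
        then have "y \<in> X" using bip[OF N] by simp
        then show False using no[OF xy(2,1) _ sym[OF N]] by simp
      qed
    qed
    moreover have "fixpts V (\<lambda>x. x) = V" by (simp add: fixpts_def)
    ultimately show ?thesis
      using pairing_id[of V N] by (intro exI[of _ "\<lambda>x. x"] exI[of _ V]) simp
  qed
qed

section \<open>Local clique numbers and graphs without triads\<close>

lemma clique_restrict:
  "W \<subseteq> verts G \<Longrightarrow> clique (G\<lparr>verts := W\<rparr>) K \<longleftrightarrow> clique G K \<and> K \<subseteq> W"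
  by (auto simp: clique_def)

lemma triad_restrict:
  "W \<subseteq> verts G \<Longrightarrow> triad (G\<lparr>verts := W\<rparr>) T \<longleftrightarrow> triad G T \<and> T \<subseteq> W"
  by (auto simp: triad_def stable_def)

lemma neighbours_restrict:
  "W \<subseteq> verts G \<Longrightarrow> neighbours (G\<lparr>verts := W\<rparr>) v = neighbours G v \<inter> W"
  by (auto simp: neighbours_def)

lemma finite_clique_cards:
  assumes "finite (verts G)"
  shows "finite {card K | K. clique G K \<and> v \<in> K}"
proof -
  have "{card K | K. clique G K \<and> v \<in> K} \<subseteq> card ` Pow (verts G)"
    by (auto simp: clique_def)
  then show ?thesis using assms by (meson finite_Pow_iff finite_imageI finite_subset)
qed

lemma card_le_local_clique_number:
  assumes "finite (verts G)" "clique G K" "v \<in> K"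
  shows "card K \<le> local_clique_number G v"
  unfolding local_clique_number_def
  by (rule Max_ge[OF finite_clique_cards[OF assms(1)]]) (use assms in blast)

lemma local_clique_number_attained:
  assumes "finite (verts G)" "v \<in> verts G"
  obtains K where "clique G K" "v \<in> K" "card K = local_clique_number G v"
proof -
  have "clique G {v}" using assms(2) by (simp add: clique_def)
  then have "{card K | K. clique G K \<and> v \<in> K} \<noteq> {}" by blast
  from Max_in[OF finite_clique_cards[OF assms(1)] this]
  obtain K where "local_clique_number G v = card K" "clique G K" "v \<in> K"
    unfolding local_clique_number_def by auto
  then show ?thesis using that[of K] by simp
qed

lemma local_clique_number_mono:
  assumes "finite (verts G)" "v \<in> verts G'" "verts G' \<subseteq> verts G"
    and "\<And>K. clique G' K \<Longrightarrow> clique G K"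
  shows "local_clique_number G' v \<le> local_clique_number G v"
proof -
  have "finite (verts G')" using assms(1,3) finite_subset by blast
  then obtain K where "clique G' K" "v \<in> K" "card K = local_clique_number G' v"
    using local_clique_number_attained[OF _ assms(2)] by metis
  then show ?thesis using card_le_local_clique_number[OF assms(1) assms(4)[of K], of v] by simp
qed

lemma degree_mono:
  assumes "finite (verts G)" "neighbours G' v \<subseteq> neighbours G v"
  shows "degree G' v \<le> degree G v"
  using assms unfolding degree_def by (intro card_mono) (auto simp: neighbours_def)

section \<open>Colourings from partitions and from pairings\<close>

lemma colourable_by_classes:
  assumes "finite (verts G)" "card (c ` verts G) \<le> k"
    and "\<And>u v. u \<in> verts G \<Longrightarrow> v \<in> verts G \<Longrightarrow> {u, v} \<in> edges G \<Longrightarrow> c u \<noteq> c v"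
  shows "colourable G k"
proof -
  obtain h where h: "bij_betw h (c ` verts G) {0..<card (c ` verts G)}"
    using ex_bij_betw_finite_nat[of "c ` verts G"] assms(1) by blast
  then have "h (c u) < k" if "u \<in> verts G" for u
    using bij_betwE[OF h] that assms(2) by fastforce
  moreover have "h (c u) \<noteq> h (c v)" if "u \<in> verts G" "v \<in> verts G" "{u, v} \<in> edges G" for u v
    using inj_onD[OF bij_betw_imp_inj_on[OF h]] that assms(3) by blast
  ultimately show ?thesis unfolding colourable_def by (intro exI[of _ "h \<circ> c"]) auto
qed

text \<open>The orbits of \<open>f\<close> are stable sets and serve as colour classes;
  \<open>card_orbits\<close> counts them.\<close>

lemma colourable_by_pairing:
  assumes fin: "finite (verts G)" and loopless: "\<And>x. {x} \<notin> edges G"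
    and f: "pairing (verts G) (\<lambda>x y. {x, y} \<notin> edges G) f"
    and k: "card (verts G) + card (fixpts (verts G) f) \<le> 2 * k"
  shows "colourable G k"
proof (rule colourable_by_classes[OF fin])
  show "card ((\<lambda>x. {x, f x}) ` verts G) \<le> k"
    using card_orbits[OF fin f] k by simp
  fix u v assume uv: "u \<in> verts G" "v \<in> verts G" "{u, v} \<in> edges G"
  then have "u \<noteq> v" using loopless by auto
  show "{u, f u} \<noteq> {v, f v}"
  proof
    assume "{u, f u} = {v, f v}"
    then have "v = f u" using \<open>u \<noteq> v\<close> by (auto simp: doubleton_eq_iff)
    then show False using f uv \<open>u \<noteq> v\<close> unfolding pairing_def by metis
  qed
qed

text \<open>Let every vertex be fixed by some optimal pairing of non-adjacent vertices. For a vertex \<open>v\<close>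
  of a maximum clique, the non-neighbours of \<open>v\<close> together with the fixed points of an optimal
  pairing that are not linked to \<open>v\<close> form a clique.\<close>

lemma pairing_without_triads:
  assumes "finite W" and loopless: "\<And>x. {x} \<notin> edges G"
    and "W \<subseteq> verts G" "finite (verts G)" and no_triad: "\<And>T. \<not> triad G T"
    and bound: "\<And>v. v \<in> verts G \<Longrightarrow> degree G v + 1 + local_clique_number G v \<le> 2 * k"
  shows "\<exists>f. pairing W (\<lambda>x y. {x, y} \<notin> edges G) f \<and> card W + card (fixpts W f) \<le> 2 * k"
  using assms(1,3)
proof (induction W rule: finite_psubset_induct)
  case (psubset W)
  let ?N = "\<lambda>x y. {x, y} \<notin> edges G"
  show ?case
  proof (cases "\<exists>v\<in>W. \<forall>f. optimal W ?N f \<longrightarrow> f v \<noteq> v")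
    case True
    then obtain v where v: "v \<in> W" "\<forall>f. optimal W ?N f \<longrightarrow> f v \<noteq> v" by blast
    then have "W - {v} \<subset> W" "W - {v} \<subseteq> verts G" using psubset.prems by auto
    \<comment> \<open>\<open>bound\<close> speaks of degrees and cliques in \<open>G\<close>, not in
      the subgraph induced by \<open>W\<close>, so it survives the deletion of
      \<open>v\<close>.\<close>
    from psubset.IH[OF this] obtain g where g: "pairing (W - {v}) ?N g"
      "card (W - {v}) + card (fixpts (W - {v}) g) \<le> 2 * k" by blast
    show ?thesis
      using pairing_extend[OF psubset.hyps v(1) g(1) v(2)] g(2) by (meson order_trans)
  next
    case False
    then have fixable: "\<exists>f. optimal W ?N f \<and> f v = v" if "v \<in> W" for v using that by blast
    have related: "linked W ?N u w" if "u \<in> W" "w \<in> W" "{u, w} \<notin> edges G" for u w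
      using linked_if_related[OF psubset.hyps that(1,2), of ?N] that(3) by (simp add: insert_commute)
    have trans: "linked W ?N u w" if v: "v \<in> W" and l: "linked W ?N u v" "linked W ?N v w" for u v w
    proof -
      obtain g where "optimal W ?N g" "g v = v" using fixable v by blast
      from linked_trans[OF psubset.hyps v this l] show ?thesis .
    qed
    obtain f where f: "optimal W ?N f" using optimal_exists by blast
    then have pf: "pairing W ?N f" by (simp add: optimal_def)
    let ?H = "G\<lparr>verts := W\<rparr>"
    have unlinked: "\<not> linked W ?N s s'" if "s \<in> fixpts W f" "s' \<in> fixpts W f" "s \<noteq> s'" for s s'
      using that f by (auto simp: linked_def fixpts_def)
    show ?thesis
    proof (cases "W = {}")
      case True
      then show ?thesis by (simp add: pairing_def fixpts_def)
    next
      case False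
      then obtain w where "w \<in> W" by blast
      then have "clique ?H {w}" by (simp add: clique_def)
      moreover have "\<forall>K. clique ?H K \<longrightarrow> card K \<le> card W"
        using psubset.hyps by (auto simp: clique_def intro: card_mono)
      ultimately obtain K where K: "clique ?H K" "\<forall>Q. clique ?H Q \<longrightarrow> card Q \<le> card K"
        using ex_has_greatest_nat[of "clique ?H" "{w}" card "Suc (card W)"] by (auto simp: less_Suc_eq_le)
      then have "card K \<ge> 1" using \<open>clique ?H {w}\<close> by fastforce
      \<comment> \<open>The clique \<open>B \<union> F\<close> below avoids \<open>v\<close>, so
        \<open>local_clique_number G v\<close> does not bound it directly. It is compared with
        \<open>K\<close>, a largest clique inside \<open>W\<close>, which contains
        \<open>v\<close>.\<close>
      then obtain v where "v \<in> K" by fastforce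
      then have "v \<in> W" using K by (auto simp: clique_def)
      then have "v \<in> verts G" using psubset.prems by auto
      define B where "B = {u\<in>W. u \<noteq> v \<and> {u, v} \<notin> edges G}"
      define F where "F = {s\<in>fixpts W f. \<not> linked W ?N v s}"
      have B_linked: "linked W ?N v u" if "u \<in> B" for u
        using that related[of v u] \<open>v \<in> W\<close> by (simp add: B_def insert_commute)
      have BW: "B \<subseteq> W" and FW: "F \<subseteq> fixpts W f" "fixpts W f \<subseteq> W"
        by (auto simp: B_def F_def fixpts_def)
      have fin: "finite B" "finite F" "finite (fixpts W f)"
        using BW FW psubset.hyps by (meson finite_subset subset_trans)+
      \<comment> \<open>A non-adjacent pair would give, within \<open>B\<close>, a triad with
        \<open>v\<close>; within \<open>F\<close>, two linked fixed points of \<open>f\<close>;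
        between \<open>B\<close> and \<open>F\<close>, a link from \<open>v\<close> to a member of
        \<open>F\<close>.\<close>
      have BB: "{x, y} \<in> edges G" if "x \<in> B" "y \<in> B" "x \<noteq> y" for x y
      proof (rule ccontr)
        assume "{x, y} \<notin> edges G"
        then have "triad G {v, x, y}"
          using that loopless psubset.prems \<open>v \<in> W\<close>
          by (auto simp: triad_def stable_def B_def insert_commute)
        then show False using no_triad by simp
      qed
      have FF: "{x, y} \<in> edges G" if "x \<in> F" "y \<in> F" "x \<noteq> y" for x y
        using related[of x y] unlinked[of x y] that FW by blast
      have BF: "{x, y} \<in> edges G" if "x \<in> B" "y \<in> F" for x y
      proof (rule ccontr)
        assume "{x, y} \<notin> edges G"
        then have "linked W ?N x y" using related[of x y] that BW FW by blast
        then have "linked W ?N v y" using trans B_linked that BW by blast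
        then show False using that by (simp add: F_def)
      qed
      have FB: "{x, y} \<in> edges G" if "x \<in> F" "y \<in> B" for x y
        using BF[OF that(2,1)] by (simp add: insert_commute)
      have "B \<union> F \<subseteq> verts G" using BW FW psubset.prems by blast
      then have "clique G (B \<union> F)"
        unfolding clique_def using BB FF BF FB by blast
      then have "clique ?H (B \<union> F)" using clique_restrict psubset.prems BW FW by blast
      then have "card (B \<union> F) \<le> card K" using K by blast
      moreover have "B \<inter> F = {}" using B_linked by (auto simp: F_def)
      then have "card (B \<union> F) = card B + card F" using fin by (simp add: card_Un_disjoint)
      moreover have "card K \<le> local_clique_number G v"
        using card_le_local_clique_number[OF assms(4) _ \<open>v \<in> K\<close>] K(1) clique_restrict psubset.prems
        by blast
      ultimately have 1: "card B + card F \<le> local_clique_number G v" by simp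
      \<comment> \<open>Fixed points of \<open>f\<close> linked to \<open>v\<close> are linked to
        each other, so there is at most one.\<close>
      have "fixpts W f - F \<subseteq> {s}" if "s \<in> fixpts W f - F" for s
      proof
        fix s' assume s': "s' \<in> fixpts W f - F"
        have "linked W ?N s s'"
          using trans[OF \<open>v \<in> W\<close>, of s s'] that s' by (simp add: F_def linked_sym)
        then show "s' \<in> {s}" using unlinked[of s s'] that s' by blast
      qed
      then have "card (fixpts W f - F) \<le> 1"
        by (metis card.empty card_mono ex_in_conv finite.emptyI finite_insert is_singletonI
            is_singleton_altdef zero_le)
      then have 2: "card (fixpts W f) \<le> card F + 1"
        using card_Diff_subset[OF fin(2) FW(1)] by simp
      have "W \<subseteq> insert v (B \<union> neighbours G v)"
        using psubset.prems by (auto simp: B_def neighbours_def)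
      moreover have "finite (neighbours G v)" using assms(4) by (simp add: neighbours_def)
      ultimately have "card W \<le> card (insert v (B \<union> neighbours G v))"
        using fin by (intro card_mono) auto
      also have "\<dots> \<le> Suc (card (B \<union> neighbours G v))" by (rule card_insert_le_m1) auto
      also have "\<dots> \<le> Suc (card B + degree G v)" unfolding degree_def using card_Un_le by auto
      finally have "card W + card (fixpts W f) \<le> 2 * k + 1"
        using 1 2 bound[OF \<open>v \<in> verts G\<close>] by linarith
      \<comment> \<open>The counts give at most \<open>card B + card F + degree G v + 2\<close>,
        hence only \<open>2 * k + 1\<close>; parity removes the excess of one.\<close>
      moreover have "even (card W + card (fixpts W f))" using pairing_parity[OF psubset.hyps pf] .
      then obtain m where "card W + card (fixpts W f) = 2 * m" by (rule evenE)
      ultimately have "card W + card (fixpts W f) \<le> 2 * k" by simp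
      then show ?thesis using pf by blast
    qed
  qed
qed

section \<open>Removing triads\<close>

text \<open>What remains of the antiprismatic condition in a skeleton: a vertex in the fibre of
  \<open>t\<close> may have \<open>t\<close> as its only neighbour in the triad, but then the closed
  neighbourhoods, written \<open>insert x (neighbours G x)\<close>, are comparable. The property
  passes to induced subgraphs, so triads can be removed one after another.\<close>

definition nested_triads :: "'a graph \<Rightarrow> bool" where
  "nested_triads G \<longleftrightarrow> (\<forall>T x. triad G T \<and> x \<in> verts G - T \<longrightarrow>
     2 \<le> card (neighbours G x \<inter> T) \<or>
     (\<exists>t. neighbours G x \<inter> T = {t} \<and>
        (insert x (neighbours G x) \<subseteq> insert t (neighbours G t) \<or>
         insert t (neighbours G t) \<subseteq> insert x (neighbours G x))))"

lemma nested_triads_restrict: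
  assumes "nested_triads G" "W \<subseteq> verts G"
  shows "nested_triads (G\<lparr>verts := W\<rparr>)"
  unfolding nested_triads_def
proof (intro allI impI)
  let ?H = "G\<lparr>verts := W\<rparr>"
  note n = neighbours_restrict[OF assms(2)]
  fix T x assume "triad ?H T \<and> x \<in> verts ?H - T"
  then have T: "triad G T" "T \<subseteq> W" and x: "x \<in> verts G - T" "x \<in> W"
    using assms(2) triad_restrict[OF assms(2)] by auto
  have eq: "neighbours ?H x \<inter> T = neighbours G x \<inter> T" unfolding n using T(2) by blast
  from assms(1) T(1) x(1) consider "2 \<le> card (neighbours G x \<inter> T)"
    | t where "neighbours G x \<inter> T = {t}"
        "insert x (neighbours G x) \<subseteq> insert t (neighbours G t) \<or>
         insert t (neighbours G t) \<subseteq> insert x (neighbours G x)"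
    unfolding nested_triads_def by blast
  then show "2 \<le> card (neighbours ?H x \<inter> T) \<or>
     (\<exists>t. neighbours ?H x \<inter> T = {t} \<and>
        (insert x (neighbours ?H x) \<subseteq> insert t (neighbours ?H t) \<or>
         insert t (neighbours ?H t) \<subseteq> insert x (neighbours ?H x)))"
  proof cases
    case 1
    then show ?thesis unfolding eq by blast
  next
    case 2
    have "t \<in> W" using 2(1) T(2) by blast
    then have eqs: "insert x (neighbours ?H x) = insert x (neighbours G x) \<inter> W"
      "insert t (neighbours ?H t) = insert t (neighbours G t) \<inter> W"
      unfolding n using x(2) by simp_all
    have "insert x (neighbours ?H x) \<subseteq> insert t (neighbours ?H t) \<or>
         insert t (neighbours ?H t) \<subseteq> insert x (neighbours ?H x)"
      unfolding eqs using 2(2) Int_mono[OF _ order_refl[of W]] by metis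
    then show ?thesis unfolding eq using 2(1) by blast
  qed
qed

lemma colourable_extend_stable:
  assumes "colourable (G\<lparr>verts := verts G - T\<rparr>) k" "stable G T"
  shows "colourable G (Suc k)"
proof -
  obtain c where c: "c ` (verts G - T) \<subseteq> {..<k}"
    "\<forall>u\<in>verts G - T. \<forall>v\<in>verts G - T. {u, v} \<in> edges G \<longrightarrow> c u \<noteq> c v"
    using assms(1) by (auto simp: colourable_def)
  let ?c = "\<lambda>x. if x \<in> T then k else c x"
  have lt: "c u < k" if "u \<in> verts G" "u \<notin> T" for u using c(1) that by auto
  have "?c ` verts G \<subseteq> {..<Suc k}" using lt by (auto intro: less_SucI)
  moreover have "?c u \<noteq> ?c v" if "u \<in> verts G" "v \<in> verts G" "{u, v} \<in> edges G" for u v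
    using that lt[of u] lt[of v] c(2) assms(2) by (auto simp: stable_def)
  ultimately show ?thesis unfolding colourable_def by blast
qed

text \<open>Choosing the triad with maximum degree sum orients the inclusion in \<^const>\<open>nested_triads\<close>:
  exchanging \<open>t\<close> for \<open>x\<close> gives another triad, so \<open>t\<close> has the larger neighbourhood and lies in every
  maximum clique through \<open>x\<close>.\<close>

lemma triad_removal_drop:
  assumes fin: "finite (verts G)" and loopless: "\<And>x. {x} \<notin> edges G"
    and nested: "nested_triads G" and T: "triad G T"
    and max: "\<And>T'. triad G T' \<Longrightarrow> sum (degree G) T' \<le> sum (degree G) T"
    and x: "x \<in> verts G - T"
  defines "G' \<equiv> G\<lparr>verts := verts G - T\<rparr>"
  shows "degree G' x + local_clique_number G' x + 2 \<le> degree G x + local_clique_number G x"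
proof -
  let ?n = "neighbours G"
  have finn: "finite (?n y)" for y using fin by (simp add: neighbours_def)
  have irr: "y \<notin> ?n y" for y using loopless by (simp add: neighbours_def)
  have "?n x \<inter> (verts G - T) = ?n x - (?n x \<inter> T)" by (auto simp: neighbours_def)
  then have "degree G' x = card (?n x) - card (?n x \<inter> T)"
    unfolding G'_def degree_def using finn by (simp add: neighbours_restrict card_Diff_subset)
  moreover have "card (?n x \<inter> T) \<le> card (?n x)" using finn by (intro card_mono) auto
  ultimately have deg: "degree G' x + card (?n x \<inter> T) = degree G x" by (simp add: degree_def)
  have xG': "x \<in> verts G'" and finG': "finite (verts G')" using x fin by (auto simp: G'_def)
  have cl: "clique G' K \<longleftrightarrow> clique G K \<and> K \<subseteq> verts G - T" for K
    unfolding G'_def by (rule clique_restrict) blast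
  have mono: "local_clique_number G' x \<le> local_clique_number G x"
    using local_clique_number_mono[OF fin xG'] cl by (simp add: G'_def)
  from nested T x consider "2 \<le> card (?n x \<inter> T)"
    | t where "?n x \<inter> T = {t}"
        "insert x (?n x) \<subseteq> insert t (?n t) \<or> insert t (?n t) \<subseteq> insert x (?n x)"
    unfolding nested_triads_def by blast
  then show ?thesis
  proof cases
    case 1
    then show ?thesis using deg mono by linarith
  next
    case 2
    have finT: "finite T" and cT: "card T = 3" and sT: "stable G T"
      using T by (auto simp: triad_def intro: card_ge_0_finite)
    have t: "t \<in> T" "t \<in> ?n x" using 2(1) by auto
    have non: "{y, x} \<notin> edges G" if "y \<in> T - {t}" for y
      using 2(1) that sT by (auto simp: neighbours_def stable_def)
    define T' where "T' = insert x (T - {t})"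
    have "stable G T'"
      unfolding stable_def T'_def
    proof (intro conjI ballI)
      show "insert x (T - {t}) \<subseteq> verts G" using sT x by (auto simp: stable_def)
      fix y z assume "y \<in> insert x (T - {t})" "z \<in> insert x (T - {t})"
      then show "{y, z} \<notin> edges G"
        using non[of y] non[of z] sT loopless[of x] by (auto simp: stable_def insert_commute)
    qed
    moreover have "card T' = 3" using finT cT t x by (simp add: T'_def)
    ultimately have "sum (degree G) T' \<le> sum (degree G) T" using max by (simp add: triad_def)
    moreover have "sum (degree G) T' = degree G x + sum (degree G) (T - {t})"
      unfolding T'_def using finT x by simp
    moreover have "sum (degree G) T = degree G t + sum (degree G) (T - {t})"
      using finT t by (simp add: sum.remove)
    ultimately have "degree G x \<le> degree G t" by simp
    then have "card (insert x (?n x)) \<le> card (insert t (?n t))"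
      using finn irr by (simp add: degree_def)
    \<comment> \<open>If the inclusion is the opposite one, the comparison of cardinalities forces
      equality.\<close>
    then have sub: "insert x (?n x) \<subseteq> insert t (?n t)"
      using 2(2) finn card_seteq[of "insert x (?n x)" "insert t (?n t)"] by auto
    \<comment> \<open>The degree drops by only one here, so the clique number must drop too:
      \<open>t\<close> has been removed and is missing from \<open>K\<close>, and
      \<open>insert t K\<close> is a clique of \<open>G\<close> through \<open>x\<close>.\<close>
    obtain K where K: "clique G' K" "x \<in> K" "card K = local_clique_number G' x"
      using local_clique_number_attained[OF finG' xG'] .
    have "K \<subseteq> insert x (?n x)" using K cl by (auto simp: clique_def neighbours_def)
    then have "K \<subseteq> insert t (?n t)" using sub by blast
    moreover have "t \<notin> K" using K(1) cl t by blast
    ultimately have "K \<subseteq> ?n t" by blast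
    then have "\<forall>y\<in>K. {y, t} \<in> edges G" by (auto simp: neighbours_def)
    moreover have "t \<in> verts G" using t by (simp add: neighbours_def)
    ultimately have "clique G (insert t K)"
      using K(1) cl by (auto simp: clique_def insert_commute)
    then have "card (insert t K) \<le> local_clique_number G x"
      using card_le_local_clique_number[OF fin] K(2) by blast
    moreover have "finite K" using K(1) finG' by (auto simp: clique_def intro: finite_subset)
    ultimately have "Suc (local_clique_number G' x) \<le> local_clique_number G x"
      using \<open>t \<notin> K\<close> K(3) by simp
    then show ?thesis using deg 2(1) by simp
  qed
qed

text \<open>\<open>k\<close> is generalised in the induction because each removed triad lowers the
  bound by two and uses one colour. Degrees and the extremal triad are taken afresh in each
  remaining graph; once no triad is left, a pairing of non-adjacent vertices finishes.\<close>

lemma colourable_if_nested_triads: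
  assumes "finite (verts G)" "\<And>x. {x} \<notin> edges G" "nested_triads G"
    and "\<And>v. v \<in> verts G \<Longrightarrow> degree G v + 1 + local_clique_number G v \<le> 2 * k"
  shows "colourable G k"
  using assms
proof (induction "card (verts G)" arbitrary: G k rule: less_induct)
  case less
  note fin = less.prems(1) and loopless = less.prems(2)
  show ?case
  proof (cases "\<exists>T. triad G T")
    case False
    then obtain f where "pairing (verts G) (\<lambda>x y. {x, y} \<notin> edges G) f"
      "card (verts G) + card (fixpts (verts G) f) \<le> 2 * k"
      using pairing_without_triads[OF fin loopless order_refl fin _ less.prems(4)] by blast
    then show ?thesis using colourable_by_pairing[OF fin loopless] by blast
  next
    case True
    then obtain T0 where "triad G T0" by blast
    moreover have "\<forall>T. triad G T \<longrightarrow> sum (degree G) T < Suc (sum (degree G) (verts G))"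
      using fin by (auto simp: triad_def stable_def less_Suc_eq_le intro: sum_mono2)
    ultimately obtain T where T: "triad G T"
      and max: "\<And>T'. triad G T' \<Longrightarrow> sum (degree G) T' \<le> sum (degree G) T"
      using ex_has_greatest_nat[of "triad G" T0 "sum (degree G)"] by blast
    then have cT: "card T = 3" and sT: "stable G T" by (auto simp: triad_def)
    then have TV: "T \<subseteq> verts G" "T \<noteq> {}" by (auto simp: stable_def)
    then obtain t where "t \<in> verts G" by blast
    then have "k \<noteq> 0" using less.prems(4)[of t] by auto
    then obtain j where j: "k = Suc j" using not0_implies_Suc by blast
    let ?G = "G\<lparr>verts := verts G - T\<rparr>"
    have "card (verts ?G) < card (verts G)"
      using TV fin by (auto intro!: psubset_card_mono)
    moreover have "degree ?G v + 1 + local_clique_number ?G v \<le> 2 * j" if "v \<in> verts ?G" for v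
      using triad_removal_drop[OF fin loopless less.prems(3) T max, of v] less.prems(4)[of v] that j
      by simp
    moreover have "nested_triads ?G" using nested_triads_restrict[OF less.prems(3)] by blast
    ultimately have "colourable ?G j"
      using less.hyps[of ?G j] fin loopless by simp
    then show ?thesis using colourable_extend_stable sT j by blast
  qed
qed

section \<open>Homogeneous pairs of cliques\<close>

text \<open>By Koenig's theorem, a maximum clique \<open>K\<close> in the union of two cliques \<open>A\<close> and \<open>B\<close> leaves
  enough disjoint non-adjacent pairs to realise every colouring that is merely injective on \<open>A\<close>,
  \<open>B\<close> and \<open>K\<close>, with the same sets of colours on \<open>A\<close> and on \<open>B\<close>.\<close>

lemma recolour_two_cliques:
  fixes R :: "'a \<Rightarrow> 'a \<Rightarrow> bool"
  assumes finA: "finite A" and finB: "finite B" and disj: "A \<inter> B = {}"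
    and sym: "\<And>x y. R x y \<Longrightarrow> R y x"
  shows "\<exists>K. (\<forall>x\<in>A \<inter> K. \<forall>y\<in>B \<inter> K. \<not> R x y) \<and>
    (\<forall>c :: 'a \<Rightarrow> 'c. inj_on c A \<and> inj_on c B \<and> (\<forall>x\<in>A \<inter> K. \<forall>y\<in>B \<inter> K. c x \<noteq> c y) \<longrightarrow>
      (\<exists>d. bij_betw d A (c ` A) \<and> bij_betw d B (c ` B) \<and> (\<forall>x\<in>A. \<forall>y\<in>B. d x = d y \<longrightarrow> R x y)))"
proof -
  \<comment> \<open>\<open>R\<close> stands for non-adjacency. Restricted to pairs across
    \<open>A\<close> and \<open>B\<close> it is bipartite, and its stable sets are the cliques of
    the union.\<close>
  define N where "N x y \<longleftrightarrow> R x y \<and> (x \<in> A \<longleftrightarrow> y \<notin> A)" for x y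
  let ?V = "A \<union> B"
  have finV: "finite ?V" using finA finB by simp
  have "\<exists>f K. pairing ?V N f \<and> K \<subseteq> ?V \<and> (\<forall>x\<in>K. \<forall>y\<in>K. \<not> N x y) \<and>
      card ?V + card (fixpts ?V f) \<le> 2 * card K"
    by (rule koenig[OF finV, of N A]) (use sym in \<open>auto simp: N_def\<close>)
  then obtain f K where f: "pairing ?V N f" and KV: "K \<subseteq> ?V"
    and K: "\<forall>x\<in>K. \<forall>y\<in>K. \<not> N x y" and card_K: "card ?V + card (fixpts ?V f) \<le> 2 * card K"
    by blast
  have ff: "f (f x) = x" and fN: "f x \<noteq> x \<Longrightarrow> N x (f x)" and fV: "f x \<in> ?V" if "x \<in> ?V" for x
    using f that unfolding pairing_def by blast+
  define A0 where "A0 = {x\<in>A. f x \<noteq> x}"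
  define B0 where "B0 = {x\<in>B. f x \<noteq> x}"
  have fA0: "f x \<in> B0" if "x \<in> A0" for x
    using fN[of x] fV[of x] ff[of x] that unfolding A0_def B0_def N_def by force
  have fB0: "f x \<in> A0" if "x \<in> B0" for x
    using fN[of x] fV[of x] ff[of x] that disj unfolding A0_def B0_def N_def by force
  have "bij_betw f A0 B0"
    using fA0 fB0 ff by (intro bij_betw_byWitness[where f' = f]) (auto simp: A0_def B0_def)
  then have "card A0 = card B0" by (rule bij_betw_same_card)
  moreover have "card ?V = card (fixpts ?V f) + (card A0 + card B0)"
  proof -
    have "?V = fixpts ?V f \<union> (A0 \<union> B0)" by (auto simp: fixpts_def A0_def B0_def)
    moreover have "fixpts ?V f \<inter> (A0 \<union> B0) = {}" "A0 \<inter> B0 = {}"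
      using disj by (auto simp: fixpts_def A0_def B0_def)
    moreover have "finite (fixpts ?V f)" "finite A0" "finite B0"
      using finA finB by (auto simp: fixpts_def A0_def B0_def)
    ultimately show ?thesis
      using card_Un_disjoint[of "fixpts ?V f" "A0 \<union> B0"] card_Un_disjoint[of A0 B0] by simp
  qed
  \<comment> \<open>\<open>?V\<close> consists of the fixed points and two sets of size
    \<open>card A0\<close>, so this is Koenig's inequality after halving.\<close>
  ultimately have card_V: "card ?V \<le> card K + card A0" using card_K by linarith
  show ?thesis
  proof (rule exI[of _ K], intro conjI allI impI)
    show "\<forall>x\<in>A \<inter> K. \<forall>y\<in>B \<inter> K. \<not> R x y" using K disj by (auto simp: N_def)
    fix c :: "'a \<Rightarrow> 'c"
    assume c: "inj_on c A \<and> inj_on c B \<and> (\<forall>x\<in>A \<inter> K. \<forall>y\<in>B \<inter> K. c x \<noteq> c y)"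
    \<comment> \<open>The colours shared by \<open>A\<close> and \<open>B\<close>. As
      \<open>c\<close> is injective on \<open>K\<close>, at least \<open>card K\<close> colours
      occur, which leaves at most \<open>card A0\<close> shared ones; each of them can be given to a
      pair of its own.\<close>
    define S where "S = c ` A \<inter> c ` B"
    have "inj_on c K"
    proof (rule inj_onI)
      fix x y assume xy: "x \<in> K" "y \<in> K" "c x = c y"
      have cK: "c u \<noteq> c v" if "u \<in> A" "v \<in> B" "u \<in> K" "v \<in> K" for u v
        using c that by blast
      have "x \<in> A \<or> x \<in> B" "y \<in> A \<or> y \<in> B" using xy KV by auto
      then consider "x \<in> A" "y \<in> A" | "x \<in> B" "y \<in> B" | "x \<in> A" "y \<in> B" | "y \<in> A" "x \<in> B"
        by blast
      then show "x = y"
      proof cases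
        case 1
        then show ?thesis using c inj_onD[of c A x y] xy(3) by blast
      next
        case 2
        then show ?thesis using c inj_onD[of c B x y] xy(3) by blast
      next
        case 3
        then show ?thesis using cK[of x y] xy by blast
      next
        case 4
        then show ?thesis using cK[of y x] xy by simp
      qed
    qed
    then have "card K = card (c ` K)" by (simp add: card_image)
    also have "\<dots> \<le> card (c ` A \<union> c ` B)"
      using KV finA finB by (intro card_mono) auto
    finally have "card K \<le> card (c ` A \<union> c ` B)" .
    moreover have "card (c ` A) + card (c ` B) = card (c ` A \<union> c ` B) + card S"
      unfolding S_def using finA finB by (intro card_Un_Int) auto
    moreover have cc: "card (c ` A) = card A" "card (c ` B) = card B"
      using c by (auto intro: card_image)
    moreover have "card ?V = card A + card B" using finA finB disj by (rule card_Un_disjoint)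
    ultimately have "card S \<le> card A0" using card_V by linarith
    then obtain A2 where A2: "A2 \<subseteq> A0" "card A2 = card S" "finite A2"
      by (rule obtain_subset_with_card_n)
    then have A2A: "A2 \<subseteq> A" by (auto simp: A0_def)
    have fA2: "f ` A2 \<subseteq> B" using A2(1) fA0 by (auto simp: B0_def)
    have ffA2: "f (f x) = x" if "x \<in> A2" for x using ff that A2A by blast
    have bij_f: "bij_betw f (f ` A2) A2"
      using ffA2 by (intro bij_betw_byWitness[where f' = f]) auto
    have finS: "finite S" using finA by (simp add: S_def)
    have SA: "S \<subseteq> c ` A" and SB: "S \<subseteq> c ` B" by (auto simp: S_def)
    obtain s where s: "bij_betw s A2 S"
      using finite_same_card_bij[OF A2(3) finS A2(2)] by blast
    have "card (A - A2) = card (c ` A - S)"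
      using A2 A2A finS SA cc by (simp add: card_Diff_subset)
    from finite_same_card_bij[OF _ _ this]
    obtain t where t: "bij_betw t (A - A2) (c ` A - S)"
      using finA by auto
    have "card (B - f ` A2) = card (c ` B - S)"
      using bij_betw_same_card[OF bij_f] fA2 A2 finS SB cc by (simp add: card_Diff_subset)
    from finite_same_card_bij[OF _ _ this]
    obtain r where r: "bij_betw r (B - f ` A2) (c ` B - S)"
      using finB by auto
    \<comment> \<open>Shared colours go to the pairs \<open>x\<close>, \<open>f x\<close> with
      \<open>x \<in> A2\<close>, the same colour at both ends; the other elements of each side take
      the remaining colours of that side.\<close>
    define d where "d = (\<lambda>x. if x \<in> A then (if x \<in> A2 then s x else t x)
      else if x \<in> f ` A2 then s (f x) else r x)"
    have "bij_betw d A2 S = bij_betw s A2 S"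
      by (rule bij_betw_cong) (use A2A in \<open>simp add: d_def subset_iff\<close>)
    moreover have "bij_betw d (A - A2) (c ` A - S) = bij_betw t (A - A2) (c ` A - S)"
      by (rule bij_betw_cong) (simp add: d_def)
    ultimately have "bij_betw d A2 S" "bij_betw d (A - A2) (c ` A - S)" using s t by blast+
    then have "bij_betw d (A2 \<union> (A - A2)) (S \<union> (c ` A - S))"
      by (rule bij_betw_combine) blast
    then have dA: "bij_betw d A (c ` A)" using A2A SA by (simp add: Un_absorb1)
    have notA: "x \<notin> A" if "x \<in> B" for x using that disj by blast
    have dfA2: "d x = (s \<circ> f) x" if "x \<in> f ` A2" for x
      using that notA fA2 unfolding d_def by (simp add: subset_iff)
    have drest: "d x = r x" if "x \<in> B - f ` A2" for x
      using that notA[of x] unfolding d_def by simp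
    have "bij_betw d (f ` A2) S = bij_betw (s \<circ> f) (f ` A2) S"
      by (rule bij_betw_cong) (rule dfA2)
    moreover have "bij_betw d (B - f ` A2) (c ` B - S) = bij_betw r (B - f ` A2) (c ` B - S)"
      by (rule bij_betw_cong) (rule drest)
    ultimately have "bij_betw d (f ` A2) S" "bij_betw d (B - f ` A2) (c ` B - S)"
      using bij_betw_trans[OF bij_f s] r by blast+
    then have "bij_betw d (f ` A2 \<union> (B - f ` A2)) (S \<union> (c ` B - S))"
      by (rule bij_betw_combine) blast
    then have dB: "bij_betw d B (c ` B)" using fA2 SB by (simp add: Un_absorb1)
    have "R x y" if xy: "x \<in> A" "y \<in> B" "d x = d y" for x y
    proof -
      have "d x \<in> c ` A" "d y \<in> c ` B"
        using bspec[OF bij_betwE[OF dA] xy(1)] bspec[OF bij_betwE[OF dB] xy(2)] .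
      then have dS: "d x \<in> S" "d y \<in> S" using xy(3) by (simp_all add: S_def)
      have x: "x \<in> A2"
      proof (rule ccontr)
        assume "x \<notin> A2"
        then have "t x \<in> c ` A - S" "d x = t x"
          using bspec[OF bij_betwE[OF t], of x] xy(1) by (simp_all add: d_def)
        then show False using dS(1) by simp
      qed
      have y: "y \<in> f ` A2"
      proof (rule ccontr)
        assume "y \<notin> f ` A2"
        then have yB: "y \<in> B - f ` A2" using xy(2) by simp
        have "r y \<in> c ` B - S" by (rule bspec[OF bij_betwE[OF r] yB])
        then show False using dS(2) drest[OF yB] by simp
      qed
      have "s x = s (f y)" using dfA2[OF y] xy(1,3) x by (simp add: d_def)
      moreover have "f y \<in> A2" using y ffA2 by auto
      ultimately have "x = f y"
        using inj_onD[OF bij_betw_imp_inj_on[OF s]] x by blast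
      then have "y = f x" using ff[of y] xy(2) by simp
      moreover have "N x (f x)" using fN[of x] x A2(1) by (simp add: A0_def subset_iff)
      ultimately show ?thesis by (simp add: N_def)
    qed
    then show "\<exists>d. bij_betw d A (c ` A) \<and> bij_betw d B (c ` B) \<and>
        (\<forall>x\<in>A. \<forall>y\<in>B. d x = d y \<longrightarrow> R x y)"
      using dA dB by blast
  qed
qed

text \<open>The two fibres over the edge \<open>e\<close> enter symmetrically, so no orientation of \<open>e\<close> is needed when
  the cliques \<open>K\<close> are chosen for all edges of a matching.\<close>

lemma recolour_fibres:
  fixes E :: "'a set set" and p :: "'a \<Rightarrow> 'b"
  assumes fin: "finite V" and "card e = 2"
  shows "\<exists>K. (\<forall>x\<in>V \<inter> K. \<forall>y\<in>V \<inter> K. {p x, p y} = e \<longrightarrow> {x, y} \<in> E) \<and>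
    (\<forall>c :: 'a \<Rightarrow> 'c. (\<forall>a\<in>e. inj_on c {x\<in>V. p x = a}) \<and>
        (\<forall>x\<in>V \<inter> K. \<forall>y\<in>V \<inter> K. {p x, p y} = e \<longrightarrow> c x \<noteq> c y) \<longrightarrow>
      (\<exists>d. (\<forall>a\<in>e. bij_betw d {x\<in>V. p x = a} (c ` {x\<in>V. p x = a})) \<and>
        (\<forall>x\<in>V. \<forall>y\<in>V. {p x, p y} = e \<and> d x = d y \<longrightarrow> {x, y} \<notin> E)))"
proof -
  obtain a b where e: "e = {a, b}" "a \<noteq> b" using assms(2) by (auto simp: card_2_iff)
  let ?P = "\<lambda>a. {x\<in>V. p x = a}"
  have cases: "x \<in> ?P a \<and> y \<in> ?P b \<or> x \<in> ?P b \<and> y \<in> ?P a"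
    if "x \<in> V" "y \<in> V" "{p x, p y} = e" for x y
    using that e by (auto simp: doubleton_eq_iff)
  have fibres: "{p x, p y} = e" if "x \<in> ?P a" "y \<in> ?P b" for x y using that e by simp
  have "\<exists>K. (\<forall>x\<in>?P a \<inter> K. \<forall>y\<in>?P b \<inter> K. \<not> {x, y} \<notin> E) \<and>
    (\<forall>c :: 'a \<Rightarrow> 'c. inj_on c (?P a) \<and> inj_on c (?P b) \<and>
        (\<forall>x\<in>?P a \<inter> K. \<forall>y\<in>?P b \<inter> K. c x \<noteq> c y) \<longrightarrow>
      (\<exists>d. bij_betw d (?P a) (c ` ?P a) \<and> bij_betw d (?P b) (c ` ?P b) \<and>
        (\<forall>x\<in>?P a. \<forall>y\<in>?P b. d x = d y \<longrightarrow> {x, y} \<notin> E)))"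
    by (rule recolour_two_cliques) (use fin e(2) in \<open>auto simp: insert_commute\<close>)
  then obtain K where K: "\<forall>x\<in>?P a \<inter> K. \<forall>y\<in>?P b \<inter> K. {x, y} \<in> E"
    and recolour: "\<forall>c :: 'a \<Rightarrow> 'c. inj_on c (?P a) \<and> inj_on c (?P b) \<and>
        (\<forall>x\<in>?P a \<inter> K. \<forall>y\<in>?P b \<inter> K. c x \<noteq> c y) \<longrightarrow>
      (\<exists>d. bij_betw d (?P a) (c ` ?P a) \<and> bij_betw d (?P b) (c ` ?P b) \<and>
        (\<forall>x\<in>?P a. \<forall>y\<in>?P b. d x = d y \<longrightarrow> {x, y} \<notin> E))"
    unfolding not_not by (elim exE conjE)
  show ?thesis
  proof (rule exI[of _ K], intro conjI allI impI ballI)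
    show "{x, y} \<in> E" if "x \<in> V \<inter> K" "y \<in> V \<inter> K" "{p x, p y} = e" for x y
    proof -
      have V: "x \<in> V" "y \<in> V" "x \<in> K" "y \<in> K" using that by auto
      from cases[OF V(1,2) that(3)] show ?thesis
      proof
        assume "x \<in> ?P a \<and> y \<in> ?P b"
        then show ?thesis using K V by blast
      next
        assume "x \<in> ?P b \<and> y \<in> ?P a"
        then have "{y, x} \<in> E" using K V by blast
        then show ?thesis by (simp add: insert_commute)
      qed
    qed
    fix c :: "'a \<Rightarrow> 'c"
    assume c: "(\<forall>a\<in>e. inj_on c (?P a)) \<and>
        (\<forall>x\<in>V \<inter> K. \<forall>y\<in>V \<inter> K. {p x, p y} = e \<longrightarrow> c x \<noteq> c y)"
    have "\<forall>x\<in>?P a \<inter> K. \<forall>y\<in>?P b \<inter> K. c x \<noteq> c y"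
    proof (intro ballI)
      fix x y assume xy: "x \<in> ?P a \<inter> K" "y \<in> ?P b \<inter> K"
      then have "{p x, p y} = e" using fibres by blast
      moreover have "x \<in> V \<inter> K" "y \<in> V \<inter> K" using xy by auto
      ultimately show "c x \<noteq> c y" using c by blast
    qed
    moreover have "inj_on c (?P a)" "inj_on c (?P b)" using c e by auto
    ultimately obtain d where d: "bij_betw d (?P a) (c ` ?P a)" "bij_betw d (?P b) (c ` ?P b)"
      "\<forall>x\<in>?P a. \<forall>y\<in>?P b. d x = d y \<longrightarrow> {x, y} \<notin> E"
      using recolour by meson
    have "{x, y} \<notin> E" if "x \<in> V" "y \<in> V" "{p x, p y} = e" "d x = d y" for x y
      using cases[OF that(1-3)]
    proof
      assume "x \<in> ?P a \<and> y \<in> ?P b"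
      then show ?thesis using d(3) that(4) by blast
    next
      assume "x \<in> ?P b \<and> y \<in> ?P a"
      then have "{y, x} \<notin> E" using d(3) that(4)[symmetric] by blast
      then show ?thesis by (simp add: insert_commute)
    qed
    moreover have "\<forall>a\<in>e. bij_betw d (?P a) (c ` ?P a)" using d(1,2) e(1) by simp
    ultimately show "\<exists>d. (\<forall>a\<in>e. bij_betw d (?P a) (c ` ?P a)) \<and>
        (\<forall>x\<in>V. \<forall>y\<in>V. {p x, p y} = e \<and> d x = d y \<longrightarrow> {x, y} \<notin> E)"
      by blast
  qed
qed

section \<open>Thickenings\<close>

text \<open>\<open>p\<close> sends a vertex to the vertex of \<open>H\<close> whose clique contains
  it. Over an edge \<open>e\<close> of \<open>M\<close> only the pairs inside the chosen clique
  \<open>K e\<close> stay adjacent; this makes closed neighbourhoods within a fibre nested, a vertex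
  in \<open>K e\<close> dominating one outside.\<close>

definition skeleton :: "'a set \<Rightarrow> ('a \<Rightarrow> 'b) \<Rightarrow> 'b graph \<Rightarrow> 'b set set \<Rightarrow> ('b set \<Rightarrow> 'a set) \<Rightarrow> 'a graph" where
  "skeleton V p H M K = \<lparr>verts = V, edges = {{x, y} | x y. x \<in> V \<and> y \<in> V \<and> x \<noteq> y \<and>
     (p x = p y \<or> {p x, p y} \<in> edges H - M \<or>
      {p x, p y} \<in> M \<and> x \<in> K {p x, p y} \<and> y \<in> K {p x, p y})}\<rparr>"

lemma verts_skeleton [simp]: "verts (skeleton V p H M K) = V"
  by (simp add: skeleton_def)

lemma edge_skeleton:
  "{x, y} \<in> edges (skeleton V p H M K) \<longleftrightarrow> x \<in> V \<and> y \<in> V \<and> x \<noteq> y \<and>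
     (p x = p y \<or> {p x, p y} \<in> edges H - M \<or>
      {p x, p y} \<in> M \<and> x \<in> K {p x, p y} \<and> y \<in> K {p x, p y})" (is "?L \<longleftrightarrow> ?R x y")
proof
  have sym: "?R v u" if "?R u v" for u v
  proof -
    have "{p v, p u} = {p u, p v}" by (rule insert_commute)
    then show ?thesis using that by auto
  qed
  assume ?L
  then obtain u v where uv: "{x, y} = {u, v}" "?R u v" by (auto simp: skeleton_def)
  then have "x = u \<and> y = v \<or> x = v \<and> y = u" by (simp add: doubleton_eq_iff)
  then show "?R x y" using uv(2) sym[OF uv(2)] by (elim disjE conjE) simp_all
next
  assume "?R x y"
  then show ?L unfolding skeleton_def by auto
qed

text \<open>Fibres are cliques and distinct fibres over an edge of \<open>H - M\<close> are complete
  to each other, so a triad projects injectively onto a triad of \<open>H - M\<close>. If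
  \<open>T\<close> avoids the fibre of \<open>x\<close>, the two neighbours of \<open>p x\<close>
  lift to \<open>T\<close>. If \<open>x\<close> and \<open>t \<in> T\<close> share a fibre, their
  closed neighbourhoods differ at most over the single edge of \<open>M\<close> at
  \<open>p x\<close>, and there membership in \<open>K\<close> nests them.\<close>

lemma nested_triads_skeleton:
  assumes "finite V" and p: "\<And>x. x \<in> V \<Longrightarrow> p x \<in> verts H"
    and H: "\<And>e. e \<in> edges H \<Longrightarrow> card e = 2" and M: "M \<subseteq> edges H" "disjoint M"
    and anti: "antiprismatic (del_edges H M)"
  shows "nested_triads (skeleton V p H M K)"
  unfolding nested_triads_def
proof (intro allI impI, elim conjE)
  let ?G = "skeleton V p H M K"
  let ?n = "neighbours ?G"
  have loop: "{a, a} \<notin> edges H" for a using H[of "{a, a}"] by auto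
  fix T x assume T: "triad ?G T" and "x \<in> verts ?G - T"
  then have x: "x \<in> V" "x \<notin> T" by auto
  have TV: "T \<subseteq> V" and cT: "card T = 3" and sT: "\<And>s t. s \<in> T \<Longrightarrow> t \<in> T \<Longrightarrow> {s, t} \<notin> edges ?G"
    using T by (auto simp: triad_def stable_def)
  have finT: "finite T" using TV assms(1) by (rule finite_subset)
  have n: "y \<in> ?n z \<longleftrightarrow> y \<in> V \<and> {z, y} \<in> edges ?G" for y z
    by (simp add: neighbours_def insert_commute)
  have inj: "inj_on p T"
  proof (rule inj_onI, rule ccontr)
    fix s t assume "s \<in> T" "t \<in> T" "p s = p t" "s \<noteq> t"
    then show False using sT[of s t] TV by (auto simp: edge_skeleton)
  qed
  have "stable (del_edges H M) (p ` T)"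
    unfolding stable_def
  proof (intro conjI ballI)
    show "p ` T \<subseteq> verts (del_edges H M)" using p TV by (auto simp: del_edges_def)
    fix a b assume "a \<in> p ` T" "b \<in> p ` T"
    then obtain s t where st: "s \<in> T" "t \<in> T" "a = p s" "b = p t" by blast
    have "{p s, p t} \<notin> edges H - M"
    proof (cases "s = t")
      case True
      then show ?thesis using loop by simp
    next
      case False
      then show ?thesis using sT[OF st(1,2)] st TV unfolding edge_skeleton by blast
    qed
    then show "{a, b} \<notin> edges (del_edges H M)" using st by (simp add: del_edges_def)
  qed
  then have triad_H: "triad (del_edges H M) (p ` T)"
    using cT inj by (simp add: triad_def card_image)
  show "2 \<le> card (?n x \<inter> T) \<or> (\<exists>t. ?n x \<inter> T = {t} \<and>
      (insert x (?n x) \<subseteq> insert t (?n t) \<or> insert t (?n t) \<subseteq> insert x (?n x)))"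
  proof (cases "p x \<in> p ` T")
    case False
    then have "card (neighbours (del_edges H M) (p x) \<inter> p ` T) = 2"
      using anti triad_H p[OF x(1)] unfolding antiprismatic_def by (simp add: del_edges_def)
    moreover have "neighbours (del_edges H M) (p x) \<inter> p ` T \<subseteq> p ` (?n x \<inter> T)"
    proof
      fix a assume a: "a \<in> neighbours (del_edges H M) (p x) \<inter> p ` T"
      then obtain t where t: "t \<in> T" "a = p t" by blast
      then have "{p x, p t} \<in> edges H - M"
        using a by (simp add: neighbours_def del_edges_def insert_commute)
      then have "t \<in> ?n x" unfolding n edge_skeleton using t TV x by blast
      then show "a \<in> p ` (?n x \<inter> T)" using t by blast
    qed
    then have "card (neighbours (del_edges H M) (p x) \<inter> p ` T) \<le> card (?n x \<inter> T)"
      using finT by (intro surj_card_le) auto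
    ultimately show ?thesis by simp
  next
    case True
    then obtain t where t: "t \<in> T" "p x = p t" by blast
    then have "x \<noteq> t" "t \<in> V" using x TV by auto
    then have tn: "t \<in> ?n x" unfolding n edge_skeleton using t x by blast
    \<comment> \<open>Disjointness of \<open>M\<close> leaves at most one edge at
      \<open>p x\<close>; if there is none, any \<open>e\<close> satisfies the property
      vacuously.\<close>
    obtain e where e: "\<And>v. {p x, v} \<in> M \<Longrightarrow> {p x, v} = e"
    proof (cases "\<exists>v. {p x, v} \<in> M")
      case True
      then obtain v where "{p x, v} \<in> M" by blast
      then have "{p x, u} = {p x, v}" if "{p x, u} \<in> M" for u
        using disjointD[OF M(2) that] by blast
      then show ?thesis using that[of "{p x, v}"] by blast
    qed blast
    have closed: "insert z (?n z) = {y\<in>V. p y = p x \<or> {p x, p y} \<in> edges H - M \<or>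
        {p x, p y} \<in> M \<and> z \<in> K e \<and> y \<in> K e}" if z: "z \<in> V" "p z = p x" for z
    proof (rule set_eqI)
      fix y
      have eq: "{p x, p y} \<in> M \<and> z \<in> K {p x, p y} \<and> y \<in> K {p x, p y} \<longleftrightarrow>
          {p x, p y} \<in> M \<and> z \<in> K e \<and> y \<in> K e"
        using e[of "p y"] by auto
      show "y \<in> insert z (?n z) \<longleftrightarrow> y \<in> {y\<in>V. p y = p x \<or> {p x, p y} \<in> edges H - M \<or>
        {p x, p y} \<in> M \<and> z \<in> K e \<and> y \<in> K e}"
        unfolding insert_iff n edge_skeleton mem_Collect_eq z(2) eq using z by auto
    qed
    have nest: "insert x (?n x) \<subseteq> insert t (?n t) \<or> insert t (?n t) \<subseteq> insert x (?n x)"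
      unfolding closed[OF x(1) refl] closed[OF \<open>t \<in> V\<close> t(2)[symmetric]] by blast
    show ?thesis
    proof (cases "?n x \<inter> T = {t}")
      case True
      then show ?thesis using nest by blast
    next
      case False
      then obtain s where "s \<in> ?n x \<inter> T" "s \<noteq> t" using tn t by blast
      then have "card {s, t} \<le> card (?n x \<inter> T)" using tn t finT by (intro card_mono) auto
      then show ?thesis using \<open>s \<noteq> t\<close> by simp
    qed
  qed
qed

text \<open>The cliques \<open>K\<close> are fixed before any colouring, because the skeleton
  depends on them. A colouring of the skeleton is then permuted inside each fibre. Fibres over an
  edge of \<open>H - M\<close> keep disjoint colour sets, being complete to each other in the
  skeleton, and over an edge of \<open>M\<close> the recolouring respects all edges of
  \<open>G\<close>.\<close>

lemma colourable_from_skeleton: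
  fixes G :: "'a graph"
  assumes fin: "finite (verts G)" and loopless: "\<And>x. {x} \<notin> edges G"
    and H: "\<And>e. e \<in> edges H \<Longrightarrow> card e = 2" and M: "M \<subseteq> edges H" "disjoint M"
    and adj: "\<And>x y. x \<in> verts G \<Longrightarrow> y \<in> verts G \<Longrightarrow> {x, y} \<in> edges G \<Longrightarrow>
      p x = p y \<or> {p x, p y} \<in> edges H"
  obtains K where
    "\<And>x y. x \<in> verts G \<Longrightarrow> y \<in> verts G \<Longrightarrow> {p x, p y} \<in> M \<Longrightarrow>
      x \<in> K {p x, p y} \<Longrightarrow> y \<in> K {p x, p y} \<Longrightarrow> {x, y} \<in> edges G"
    "\<And>k. colourable (skeleton (verts G) p H M K) k \<Longrightarrow> colourable G k"
proof -
  let ?V = "verts G"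
  let ?P = "\<lambda>a. {x\<in>?V. p x = a}"
  let ?clq = "\<lambda>e K. \<forall>x\<in>?V \<inter> K. \<forall>y\<in>?V \<inter> K. {p x, p y} = e \<longrightarrow> {x, y} \<in> edges G"
  let ?pre = "\<lambda>e K c. (\<forall>a\<in>e. inj_on c (?P a)) \<and>
    (\<forall>x\<in>?V \<inter> K. \<forall>y\<in>?V \<inter> K. {p x, p y} = e \<longrightarrow> c x \<noteq> c y)"
  let ?post = "\<lambda>e c d. (\<forall>a\<in>e. bij_betw d (?P a) (c ` ?P a)) \<and>
    (\<forall>x\<in>?V. \<forall>y\<in>?V. {p x, p y} = e \<and> d x = d y \<longrightarrow> {x, y} \<notin> edges G)"
  have loop: "a \<noteq> b" if "{a, b} \<in> edges H" for a b using H[OF that] by auto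
  have "\<forall>e\<in>M. \<exists>K. ?clq e K \<and> (\<forall>c :: 'a \<Rightarrow> nat. ?pre e K c \<longrightarrow> (\<exists>d. ?post e c d))"
  proof
    fix e assume "e \<in> M"
    then have "card e = 2" using M H by blast
    then show "\<exists>K. ?clq e K \<and> (\<forall>c :: 'a \<Rightarrow> nat. ?pre e K c \<longrightarrow> (\<exists>d. ?post e c d))"
      by (rule recolour_fibres[OF fin])
  qed
  from bchoice[OF this] obtain K where K: "\<forall>e\<in>M. ?clq e (K e) \<and>
    (\<forall>c :: 'a \<Rightarrow> nat. ?pre e (K e) c \<longrightarrow> (\<exists>d. ?post e c d))" by (elim exE)
  let ?G = "skeleton ?V p H M K"
  show thesis
  proof (rule that[of K])
    fix x y assume xy: "x \<in> ?V" "y \<in> ?V" "{p x, p y} \<in> M" "x \<in> K {p x, p y}" "y \<in> K {p x, p y}"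
    have "?clq {p x, p y} (K {p x, p y})" by (rule conjunct1[OF bspec[OF K xy(3)]])
    then show "{x, y} \<in> edges G" using xy by blast
  next
    fix k assume "colourable ?G k"
    then obtain c where ck: "c ` ?V \<subseteq> {..<k}"
      and c: "\<And>u v. u \<in> ?V \<Longrightarrow> v \<in> ?V \<Longrightarrow> {u, v} \<in> edges ?G \<Longrightarrow> c u \<noteq> c v"
      unfolding colourable_def by auto
    have cinj: "inj_on c (?P a)" for a
    proof (rule inj_onI, rule ccontr)
      fix u v assume "u \<in> ?P a" "v \<in> ?P a" "c u = c v" "u \<noteq> v"
      then show False using c[of u v] by (auto simp: edge_skeleton)
    qed
    have "\<forall>e\<in>M. \<exists>d. ?post e c d"
    proof
      fix e assume e: "e \<in> M"
      have "c x \<noteq> c y" if "x \<in> ?V \<inter> K e" "y \<in> ?V \<inter> K e" "{p x, p y} = e" for x y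
      proof -
        have "p x \<noteq> p y" using loop that(3) e M(1) by blast
        then have "x \<noteq> y" by blast
        moreover have "{p x, p y} \<in> M" "x \<in> K {p x, p y}" "y \<in> K {p x, p y}"
          unfolding that(3) using that(1,2) e by simp_all
        moreover have "x \<in> ?V" "y \<in> ?V" using that(1,2) by simp_all
        ultimately show ?thesis using c[of x y] unfolding edge_skeleton by blast
      qed
      then have pre: "?pre e (K e) c" using cinj by simp
      have "\<forall>c :: 'a \<Rightarrow> nat. ?pre e (K e) c \<longrightarrow> (\<exists>d. ?post e c d)"
        by (rule conjunct2[OF bspec[OF K e]])
      from mp[OF spec[OF this] pre] show "\<exists>d. ?post e c d" .
    qed
    from bchoice[OF this] obtain d where d: "\<forall>e\<in>M. ?post e c (d e)" by (elim exE)
    \<comment> \<open>As \<open>M\<close> is disjoint, \<open>SOME\<close> has only one candidate,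
      so no fibre is recoloured twice; fibres that \<open>M\<close> misses keep
      \<open>c\<close>.\<close>
    define D where "D = (\<lambda>x. if \<exists>e\<in>M. p x \<in> e then d (SOME e. e \<in> M \<and> p x \<in> e) x else c x)"
    have De: "D x = d e x" if e: "e \<in> M" "p x \<in> e" for e x
    proof -
      have "(SOME e. e \<in> M \<and> p x \<in> e) = e"
      proof (rule some_equality)
        show "e \<in> M \<and> p x \<in> e" using e by simp
        show "e' = e" if "e' \<in> M \<and> p x \<in> e'" for e'
          using disjointD[OF M(2), of e' e] that e by blast
      qed
      then show ?thesis using e by (auto simp: D_def)
    qed
    have Dbij: "bij_betw D (?P a) (c ` ?P a)" for a
    proof (cases "\<exists>e\<in>M. a \<in> e")
      case True
      then obtain e where e: "e \<in> M" "a \<in> e" by blast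
      then have "bij_betw (d e) (?P a) (c ` ?P a)" using d by blast
      moreover have "D x = d e x" if "x \<in> ?P a" for x using De[of e x] that e by simp
      ultimately show ?thesis using bij_betw_cong[of "?P a" D "d e"] by blast
    next
      case False
      then have "D x = c x" if "x \<in> ?P a" for x using that by (auto simp: D_def)
      moreover have "bij_betw c (?P a) (c ` ?P a)" using cinj by (rule inj_on_imp_bij_betw)
      ultimately show ?thesis using bij_betw_cong[of "?P a" D c] by blast
    qed
    have Dc: "\<exists>x'. x' \<in> ?V \<and> p x' = p x \<and> D x = c x'" if "x \<in> ?V" for x
    proof -
      have "D x \<in> c ` ?P (p x)" using bij_betwE[OF Dbij[of "p x"]] that by simp
      then show ?thesis by auto
    qed
    have "D x < k" if x: "x \<in> ?V" for x
    proof -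
      obtain x' where "x' \<in> ?V" "D x = c x'" using Dc[OF x] by blast
      then show ?thesis using ck by auto
    qed
    moreover have "D u \<noteq> D v" if uv: "u \<in> ?V" "v \<in> ?V" "{u, v} \<in> edges G" for u v
    proof
      assume eq: "D u = D v"
      have "u \<noteq> v" using uv loopless by auto
      from adj[OF uv] consider "p u = p v" | "{p u, p v} \<in> M" | "{p u, p v} \<in> edges H - M" by blast
      then show False
      proof cases
        case 1
        then show False
          using inj_onD[OF bij_betw_imp_inj_on[OF Dbij[of "p v"]] eq] uv \<open>u \<noteq> v\<close> by simp
      next
        case 2
        then have "d {p u, p v} u = d {p u, p v} v" using De[of "{p u, p v}"] eq by simp
        moreover have "?post {p u, p v} c (d {p u, p v})" using d 2 by blast
        ultimately show False using uv by blast
      next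
        \<comment> \<open>\<open>D u\<close> and \<open>D v\<close> are the \<open>c\<close>-colours
          of some \<open>u'\<close> and \<open>v'\<close> in the same fibres, and these two are
          adjacent in the skeleton.\<close>
        case 3
        obtain u' where u': "u' \<in> ?V" "p u' = p u" "D u = c u'" using Dc[OF uv(1)] by blast
        obtain v' where v': "v' \<in> ?V" "p v' = p v" "D v = c v'" using Dc[OF uv(2)] by blast
        have "p u \<noteq> p v" using 3 loop by blast
        then have "u' \<noteq> v'" using u' v' by auto
        then have "{u', v'} \<in> edges ?G" using u' v' 3 by (simp add: edge_skeleton)
        then show False using c[OF u'(1) v'(1)] u' v' eq by simp
      qed
    qed
    ultimately show "colourable G k" unfolding colourable_def by (intro exI[of _ D]) auto
  qed
qed

text \<open>Trades the fibres \<open>I\<close> and the removed edges \<open>R\<close> for one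
  projection, which is unambiguous because the fibres are disjoint. Adjacency over edges of
  \<open>M\<close> is left open, since \<open>R\<close> takes edges only there.\<close>

lemma thickening_projection:
  assumes H: "simple_graph H" and M: "M \<subseteq> edges H" and "thickening G H M"
  obtains p where "\<And>x. x \<in> verts G \<Longrightarrow> p x \<in> verts H"
    "\<And>x y. x \<in> verts G \<Longrightarrow> y \<in> verts G \<Longrightarrow> {x, y} \<in> edges G \<Longrightarrow>
      p x = p y \<or> {p x, p y} \<in> edges H"
    "\<And>x y. x \<in> verts G \<Longrightarrow> y \<in> verts G \<Longrightarrow> x \<noteq> y \<Longrightarrow>
      p x = p y \<or> {p x, p y} \<in> edges H - M \<Longrightarrow> {x, y} \<in> edges G"
proof -
  obtain I R where disj: "disjoint_family_on I (verts H)"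
    and VG: "verts G = (\<Union>v\<in>verts H. I v)"
    and R: "R \<subseteq> \<Union>{edges_between (I u) (I v) | u v. {u, v} \<in> M}"
    and EG: "edges G = blowup_edges H I - R"
    using assms(3) unfolding thickening_def by blast
  have H2: "e \<subseteq> verts H" "card e = 2" if "e \<in> edges H" for e
    using H that by (auto simp: simple_graph_def)
  have Hv: "u \<in> verts H" "v \<in> verts H" "u \<noteq> v" if "{u, v} \<in> edges H" for u v
    using H2[OF that] by auto
  define p where "p x = (SOME v. v \<in> verts H \<and> x \<in> I v)" for x
  have px: "p x \<in> verts H \<and> x \<in> I (p x)" if "x \<in> verts G" for x
    unfolding p_def by (rule someI_ex) (use that VG in auto)
  have pI: "p x = v" if "v \<in> verts H" "x \<in> I v" for x v
  proof (rule ccontr)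
    assume "p x \<noteq> v"
    moreover have "x \<in> verts G" using that VG by blast
    ultimately show False using disjoint_family_onD[OF disj, of "p x" v] px that by blast
  qed
  have between: "{p x, p y} = {u, v}"
    if xy: "{x, y} \<in> edges_between (I u) (I v)" and uv: "{u, v} \<in> edges H" for x y u v
  proof -
    obtain s t where st: "{x, y} = {s, t}" "s \<in> I u" "t \<in> I v"
      using xy unfolding edges_between_def by blast
    have "p s = u" "p t = v" using pI st Hv[OF uv] by blast+
    then have "p ` {s, t} = {u, v}" by simp
    moreover have "p ` {x, y} = {p x, p y}" by simp
    ultimately show ?thesis using st(1) by simp
  qed
  show thesis
  proof (rule that[of p])
    show "p x \<in> verts H" if "x \<in> verts G" for x using px that by blast
    show "p x = p y \<or> {p x, p y} \<in> edges H" if "{x, y} \<in> edges G" for x y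
    proof -
      have "{x, y} \<in> blowup_edges H I" using that EG by blast
      then consider s t v where "{x, y} = {s, t}" "v \<in> verts H" "s \<in> I v" "t \<in> I v"
        | u v where "{u, v} \<in> edges H" "{x, y} \<in> edges_between (I u) (I v)"
        unfolding blowup_edges_def by blast
      then show ?thesis
      proof cases
        case 1
        then have "p s = v" "p t = v" using pI by blast+
        then show ?thesis using 1(1) by (auto simp: doubleton_eq_iff)
      next
        case 2
        then show ?thesis using between by simp
      qed
    qed
    show "{x, y} \<in> edges G" if x: "x \<in> verts G" and y: "y \<in> verts G" and "x \<noteq> y"
      and pp: "p x = p y \<or> {p x, p y} \<in> edges H - M" for x y
    proof -
      have I: "x \<in> I (p x)" "y \<in> I (p y)" "p x \<in> verts H" using px x y by blast+
      have "{x, y} \<in> blowup_edges H I"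
        using pp
      proof
        assume "p x = p y"
        then show ?thesis using I \<open>x \<noteq> y\<close> unfolding blowup_edges_def by auto
      next
        assume "{p x, p y} \<in> edges H - M"
        moreover have "{x, y} \<in> edges_between (I (p x)) (I (p y))"
          using I unfolding edges_between_def by blast
        ultimately show ?thesis unfolding blowup_edges_def by blast
      qed
      moreover have "{x, y} \<notin> R"
      proof
        assume "{x, y} \<in> R"
        then obtain u v where uv: "{u, v} \<in> M" "{x, y} \<in> edges_between (I u) (I v)" using R by blast
        then have "{p x, p y} = {u, v}" using between M by blast
        moreover have "u \<noteq> v" using Hv uv M by blast
        ultimately have "{p x, p y} \<in> M" "p x \<noteq> p y" using uv by auto
        then show False using pp by blast
      qed
      ultimately show ?thesis using EG by blast
    qed
  qed
qed

text \<open>Doubling removes the ceiling and yields the form of the bound in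
  \<open>colourable_if_nested_triads\<close>.\<close>

lemma gamma_local_bound:
  assumes "finite (verts G)" "v \<in> verts G"
  shows "degree G v + 1 + local_clique_number G v \<le> 2 * gamma_local G"
proof -
  let ?m = "degree G v + 1 + local_clique_number G v"
  have "nat \<lceil>(1/2 :: real) * real ?m\<rceil> \<le> gamma_local G"
    unfolding gamma_local_def
    by (rule cSUP_upper[OF assms(2)]) (use assms(1) in simp)
  then have "(1/2 :: real) * real ?m \<le> real (gamma_local G)" by linarith
  then have "real ?m \<le> real (2 * gamma_local G)" by simp
  then show ?thesis by (simp only: of_nat_le_iff)
qed

theorem theorem2p6:
  fixes G :: "'a graph" and H :: "'b graph" and M :: "'b set set"
  assumes "simple_graph G"
    and "antiprismatic_thickening G H M"
  shows "chromatic_number G \<le> gamma_local G"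
proof -
  have fin: "finite (verts G)" using assms(1) by (simp add: simple_graph_def)
  have "card {x} \<noteq> 2" for x :: 'a by simp
  then have loopless: "{x} \<notin> edges G" for x using assms(1) unfolding simple_graph_def by blast
  \<comment> \<open>\<open>anti\<close> is the instance \<open>M' = M\<close> of
    \<open>changeable\<close>.\<close>
  have H: "simple_graph H" and M: "M \<subseteq> edges H" "disjoint M" and thick: "thickening G H M"
    and anti: "antiprismatic (del_edges H M)"
    using assms(2) by (auto simp: antiprismatic_thickening_def matching_def changeable_def)
  have H2: "card e = 2" if "e \<in> edges H" for e using H that by (simp add: simple_graph_def)
  obtain p where p: "\<And>x. x \<in> verts G \<Longrightarrow> p x \<in> verts H"
    and adj: "\<And>x y. x \<in> verts G \<Longrightarrow> y \<in> verts G \<Longrightarrow> {x, y} \<in> edges G \<Longrightarrow>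
      p x = p y \<or> {p x, p y} \<in> edges H"
    and complete: "\<And>x y. x \<in> verts G \<Longrightarrow> y \<in> verts G \<Longrightarrow> x \<noteq> y \<Longrightarrow>
      p x = p y \<or> {p x, p y} \<in> edges H - M \<Longrightarrow> {x, y} \<in> edges G"
    by (rule thickening_projection[OF H M(1) thick]) (rule that)
  obtain K where K: "\<And>x y. x \<in> verts G \<Longrightarrow> y \<in> verts G \<Longrightarrow> {p x, p y} \<in> M \<Longrightarrow>
      x \<in> K {p x, p y} \<Longrightarrow> y \<in> K {p x, p y} \<Longrightarrow> {x, y} \<in> edges G"
    and recolour: "\<And>k. colourable (skeleton (verts G) p H M K) k \<Longrightarrow> colourable G k"
    by (rule colourable_from_skeleton[OF fin loopless H2 M adj]) (assumption+, rule that)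
  let ?G = "skeleton (verts G) p H M K"
  \<comment> \<open>The skeleton is a subgraph of \<open>G\<close> on the same vertices, so upper
    bounds on degrees and clique numbers carry over from \<open>G\<close>.\<close>
  have sub: "{x, y} \<in> edges G" if "{x, y} \<in> edges ?G" for x y
    using that complete[of x y] K[of x y] unfolding edge_skeleton by blast
  have "colourable ?G (gamma_local G)"
  proof (rule colourable_if_nested_triads)
    show "finite (verts ?G)" using fin by simp
    show "{x} \<notin> edges ?G" for x using edge_skeleton[of x x] by simp
    show "nested_triads ?G" by (rule nested_triads_skeleton[OF fin p H2 M anti])
    fix v assume v: "v \<in> verts ?G"
    have "degree ?G v \<le> degree G v"
      by (rule degree_mono[OF fin]) (use sub in \<open>auto simp: neighbours_def\<close>)
    moreover have "local_clique_number ?G v \<le> local_clique_number G v"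
      by (rule local_clique_number_mono[OF fin v]) (use sub in \<open>auto simp: clique_def\<close>)
    ultimately show "degree ?G v + 1 + local_clique_number ?G v \<le> 2 * gamma_local G"
      using gamma_local_bound[OF fin, of v] v by simp
  qed
  then have "colourable G (gamma_local G)" by (rule recolour)
  then show ?thesis unfolding chromatic_number_def by (rule Least_le)
qed

end
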